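(* Let $\mathcal A=H_0+\mathcal A_0$ be a trace compatible affine space of self-adjoint operators on $\mathcal H$ satisfying the Limiting Absorption Assumption. Let $H_0,H_1\in\mathcal A$ and let $\{H_r\}_{r\in[0,1]}$ be a piecewise linear path in $\mathcal A$ connecting $H_0$ and $H_1$. Then for all $\lambda\in\Lambda$ $$S(\lambda;H_1,H_0)=\mathrm{T}\!\exp\Big(-2\pi i\int_0^1 w_+(\lambda;H_0,H_r)\,\Pi_{H_r}(\dot H_r)(\lambda)\,w_+(\lambda;H_r,H_0)\,dr\Big),$$ where $\dot H_r$ is the derivative of the path (defined for all but finitely many $r$, with values in $\mathcal A_0$).
   Context: $\mathcal H$ is a separable complex Hilbert space; $\mathfrak S_p(\cdot)$ is the Schatten ideal ($\mathfrak S_1$ = trace class, $\mathfrak S_\infty$ = compact operators). Trace compatible affine space: $\mathcal A=H_0+\mathcal A_0$ with $H_0$ a self-adjoint operator on $\mathcal H$ and $\mathcal A_0$ a real vector subspace of the bounded self-adjoint operators, such that (1) $V\varphi(H)\in\mathfrak S_1(\mathcal H)$ for all $\varphi\in C_c^\infty(\mathbb R)$, $V\in\mathcal A_0$, $H\in\mathcal A$; (2) $\mathcal A_0$ is endowed with a locally convex topology equal to or stronger than the uniform (operator norm) topology such that $(V_1,V_2)\in\mathcal A_0^2\mapsto V_1\varphi(H+V_2)$ is $\mathfrak S_1$-continuous for all $H\in\mathcal A$, $\varphi\in C^\infty_c(\mathbb R)$; (3) every $V\in\mathcal A_0$ is $V_1-V_2$ with $0\le V_1,V_2\in\mathcal A_0$.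 Wave and scattering operators: for $H_0,H_1\in\mathcal A$ the strong limits $W_\pm(H_1,H_0)=\lim_{t\to\pm\infty}e^{itH_1}e^{-itH_0}P_a(H_0)$ exist and are complete, where $P_a(H)$ is the projection onto the absolutely continuous subspace $\mathcal H^{(a)}(H)$. $\mathbf S(H_1,H_0)=W_+(H_1,H_0)^*W_-(H_1,H_0)$ is unitary on $\mathcal H^{(a)}(H_0)$. All $H\in\mathcal A$ have the same absolutely continuous spectrum $\sigma^{(a)}$; $\Lambda$ denotes its interior. Direct integrals: for $H\in\mathcal A$, $\mathcal F_H:\mathcal H^{(a)}(H)\to\int^\oplus_{\sigma^{(a)}}\mathfrak h_\lambda^{(H)}\,d\lambda$ is a unitary map diagonalizing $H$, i.e. $(\mathcal F_H H\eta)(\lambda)=\lambda(\mathcal F_H\eta)(\lambda)$ (with $\mathcal F_H$ extended by zero to the singular subspace). Factorization: each $V\in\mathcal A_0$ is factored as $V=G^*JG$ with $G:\mathcal H\to\mathcal K$ bounded, $\mathcal K$ an auxiliary Hilbert space, and $J=J^*$ invertible on $\mathcal K$ (e.g. $G=\sqrt{|V|}$, $J=\mathrm{sgn}(V)$); for $rV$ the factorization $G^*(rJ)G$ is used. Let $R_z(H)=(H-z)^{-1}$. Limiting Absorption Assumption: (i) there is $p\in[1,\infty]$ such that for all $H\in\mathcal A$, $V\in\mathcal A_0$, the function $T(z)=GR_z(H)G^*$ takes values in $\mathfrak S_p(\mathcal K)$ for $\operatorname{Im}z\ne0$, and for all $\lambda\in\Lambda$ has non-tangential limit values $T(\lambda\pm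 i0)$ in $\mathfrak S_p(\mathcal K)$; (ii) $B(\lambda\pm i0):=\operatorname{Im}T(\lambda\pm i0)\in\mathfrak S_1(\mathcal K)$ for all $\lambda\in\Lambda$. Pointwise objects: under this assumption $Z_H(\lambda;G)\eta=(\mathcal F_HG^*\eta)(\lambda)$ defines for every $\lambda\in\Lambda$ a Hilbert–Schmidt operator $Z_H(\lambda;G):\mathcal K\to\mathfrak h_\lambda^{(H)}$ with $\pi Z_H(\lambda;G)^*Z_H(\lambda;G)=B(\lambda+i0)$. The infinitesimal scattering matrix is $\Pi_H(V)(\lambda)=Z_H(\lambda;G)\,J\,Z_H(\lambda;G)^*$, a trace class self-adjoint operator on $\mathfrak h^{(H)}_\lambda$. The scattering matrix $S(\lambda;H_1,H_0)$ (unitary on $\mathfrak h_\lambda^{(H_0)}$) is the fibre at $\lambda$ of $\mathbf S(H_1,H_0)$, and $w_\pm(\lambda;H_1,H_0):\mathfrak h_\lambda^{(H_0)}\to\mathfrak h_\lambda^{(H_1)}$ (unitary) is the fibre at $\lambda$ of $W_\pm(H_1,H_0)$, i.e. $(\mathcal F_{H_1}W_\pm(H_1,H_0)\eta)(\lambda)=w_\pm(\lambda;H_1,H_0)(\mathcal F_{H_0}\eta)(\lambda)$. Their values at every $\lambda\in\Lambda$ are those given by stationary scattering theory: with $H_1=H_0+V$, $V=G^*JG$, $T_j(z)=GR_z(H_j)G^*$, $Z_j=Z_{H_j}(\lambda;G)$, $$S(\lambda;H_1,H_0)=1-2\pi i\,Z_0J(1+T_0(\lambda+i0)J)^{-1}Z_0^*,\qquad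 w_\pm(\lambda;H_1,H_0)Z_0(1-JT_1(\lambda\pm i0))=Z_1,$$ and for every $\lambda\in\Lambda$: $S(\lambda;H_1,H_0)=w_+(\lambda;H_1,H_0)^*w_-(\lambda;H_1,H_0)$, $w_\pm(\lambda;H_1,H_0)^*=w_\pm(\lambda;H_0,H_1)$, $w_\pm(\lambda;H_2,H_0)=w_\pm(\lambda;H_2,H_1)w_\pm(\lambda;H_1,H_0)$. Chronological exponential: for a piecewise continuous path $A:[0,1]\to\mathfrak S_1$ of self-adjoint operators, $$\mathrm{T}\!\exp\Big(-2\pi i\int_0^1A(s)\,ds\Big)=1+\sum_{k=1}^\infty(-2\pi i)^k\int_0^1dt_1\int_0^{t_1}dt_2\cdots\int_0^{t_{k-1}}dt_k\,A(t_1)\cdots A(t_k).$$ *)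

theory Defs
  imports "HOL-Analysis.Analysis"
begin

section \<open>Complex Hilbert spaces and bounded operators\<close>

text \<open>The inner product is conjugate linear in the first argument. The real inner product, and hence
  the norm, are those of the underlying real Hilbert space.\<close>

class complex_hilbert = real_inner + complete_space +
  fixes scaleC :: "complex \<Rightarrow> 'a \<Rightarrow> 'a"  (infixr \<open>*\<^sub>C\<close> 75)
    and cinner :: "'a \<Rightarrow> 'a \<Rightarrow> complex"
  assumes scaleC_add_right: "c *\<^sub>C (x + y) = c *\<^sub>C x + c *\<^sub>C y"
    and scaleC_add_left: "(c + d) *\<^sub>C x = c *\<^sub>C x + d *\<^sub>C x"
    and scaleC_scaleC: "c *\<^sub>C (d *\<^sub>C x) = (c * d) *\<^sub>C x"
    and scaleC_of_real: "complex_of_real r *\<^sub>C x = r *\<^sub>R x"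
    and cinner_commute: "cinner x y = cnj (cinner y x)"
    and cinner_add_right: "cinner x (y + z) = cinner x y + cinner x z"
    and cinner_scaleC_right: "cinner x (c *\<^sub>C y) = c * cinner x y"
    and inner_eq_Re_cinner: "inner x y = Re (cinner x y)"

text \<open>The type of bounded operators \<open>'a \<Rightarrow>\<^sub>L 'b\<close> of the library only provides real linearity, complex
  linearity is the predicate \<open>clin\<close>.\<close>

definition clin :: "('a::complex_hilbert \<Rightarrow>\<^sub>L 'b::complex_hilbert) \<Rightarrow> bool"
  where "clin T \<longleftrightarrow> (\<forall>c x. T (c *\<^sub>C x) = c *\<^sub>C T x)"

definition scale_op ::
    "complex \<Rightarrow> ('a::complex_hilbert \<Rightarrow>\<^sub>L 'b::complex_hilbert) \<Rightarrow> 'a \<Rightarrow>\<^sub>L 'b"  (infixr \<open>*\<^sub>O\<close> 75)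
  where "c *\<^sub>O T = Blinfun (\<lambda>x. c *\<^sub>C T x)"

definition adj :: "('a::complex_hilbert \<Rightarrow>\<^sub>L 'b::complex_hilbert) \<Rightarrow> 'b \<Rightarrow>\<^sub>L 'a"
  where "adj T = (THE R::'b \<Rightarrow>\<^sub>L 'a. \<forall>x y. cinner (T x) y = cinner x (R y))"

text \<open>Bounded self-adjoint operators (complex linearity follows).\<close>

definition hermitian :: "('a::complex_hilbert \<Rightarrow>\<^sub>L 'a) \<Rightarrow> bool"
  where "hermitian T \<longleftrightarrow> (\<forall>x y. cinner (T x) y = cinner x (T y))"

definition positive_op :: "('a::complex_hilbert \<Rightarrow>\<^sub>L 'a) \<Rightarrow> bool"
  where "positive_op T \<longleftrightarrow> hermitian T \<and> (\<forall>x. 0 \<le> Re (cinner x (T x)))"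

definition Im_op :: "('a::complex_hilbert \<Rightarrow>\<^sub>L 'a) \<Rightarrow> 'a \<Rightarrow>\<^sub>L 'a"
  where "Im_op T = (1 / (2 * \<i>)) *\<^sub>O (T - adj T)"

definition invertible_op :: "('a::complex_hilbert \<Rightarrow>\<^sub>L 'a) \<Rightarrow> bool"
  where "invertible_op T \<longleftrightarrow> (\<exists>R. T o\<^sub>L R = id_blinfun \<and> R o\<^sub>L T = id_blinfun)"

definition inv_op :: "('a::complex_hilbert \<Rightarrow>\<^sub>L 'a) \<Rightarrow> 'a \<Rightarrow>\<^sub>L 'a"
  where "inv_op T = (THE R. T o\<^sub>L R = id_blinfun \<and> R o\<^sub>L T = id_blinfun)"

definition cspan :: "'a::complex_hilbert set \<Rightarrow> 'a set"
  where "cspan X = span (X \<union> (\<lambda>x. \<i> *\<^sub>C x) ` X)"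

definition closed_csubspace :: "'a::complex_hilbert set \<Rightarrow> bool"
  where "closed_csubspace M \<longleftrightarrow> closed M \<and> subspace M \<and> (\<forall>c. \<forall>x\<in>M. c *\<^sub>C x \<in> M)"

definition orth_proj :: "'a::complex_hilbert set \<Rightarrow> 'a \<Rightarrow>\<^sub>L 'a"
  where "orth_proj M = Blinfun (\<lambda>x. THE y. y \<in> M \<and> (\<forall>z\<in>M. cinner z (x - y) = 0))"

text \<open>An operator between closed subspaces \<open>M\<close>, \<open>N\<close> is represented by its extension by zero to the
  orthogonal complement of \<open>M\<close>; the identity operator of \<open>M\<close> is thus \<open>orth_proj M\<close>.\<close>

definition unitary_between ::
    "'a::complex_hilbert set \<Rightarrow> 'a set \<Rightarrow> ('a \<Rightarrow>\<^sub>L 'a) \<Rightarrow> bool"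
  where "unitary_between M N U \<longleftrightarrow>
    clin U \<and> adj U o\<^sub>L U = orth_proj M \<and> U o\<^sub>L adj U = orth_proj N"


section \<open>Schatten ideals\<close>

text \<open>Singular numbers, numbered from 0, as approximation numbers (distance to the operators of rank
  at most \<open>n\<close>).\<close>

definition rank_le :: "nat \<Rightarrow> ('a::complex_hilbert \<Rightarrow>\<^sub>L 'b::complex_hilbert) \<Rightarrow> bool"
  where "rank_le n T \<longleftrightarrow> (\<exists>X. finite X \<and> card X \<le> n \<and> range (blinfun_apply T) \<subseteq> cspan X)"

definition sing_num :: "nat \<Rightarrow> ('a::complex_hilbert \<Rightarrow>\<^sub>L 'b::complex_hilbert) \<Rightarrow> real"
  where "sing_num n T = Inf {norm (T - R) |R. clin R \<and> rank_le n R}"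

definition schatten :: "ereal \<Rightarrow> ('a::complex_hilbert \<Rightarrow>\<^sub>L 'b::complex_hilbert) \<Rightarrow> bool"
  where "schatten p T \<longleftrightarrow> clin T \<and>
    (if p = \<infinity> then compact (closure (blinfun_apply T ` cball 0 1))
     else summable (\<lambda>n. sing_num n T powr real_of_ereal p))"

definition schatten_norm :: "ereal \<Rightarrow> ('a::complex_hilbert \<Rightarrow>\<^sub>L 'b::complex_hilbert) \<Rightarrow> real"
  where "schatten_norm p T =
    (if p = \<infinity> then norm T
     else (\<Sum>n. sing_num n T powr real_of_ereal p) powr (1 / real_of_ereal p))"


section \<open>Self-adjoint operators\<close>

text \<open>Unbounded operators are represented by their graphs. Density of the domain makes the adjoint
  graph single-valued, and an adjoint graph is always a closed linear subspace, so that
  \<open>self_adjoint\<close> entails that \<open>H\<close> is the graph of a linear operator.\<close>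

type_synonym 'a graph_op = "('a \<times> 'a) set"

definition adj_graph :: "'a::complex_hilbert graph_op \<Rightarrow> 'a graph_op"
  where "adj_graph H = {(x, y). \<forall>(u, v)\<in>H. cinner v x = cinner u y}"

definition self_adjoint :: "'a::complex_hilbert graph_op \<Rightarrow> bool"
  where "self_adjoint H \<longleftrightarrow> closure (Domain H) = UNIV \<and> adj_graph H = H"

definition perturb ::
    "'a::complex_hilbert graph_op \<Rightarrow> ('a \<Rightarrow>\<^sub>L 'a) \<Rightarrow> 'a graph_op"  (infixl \<open>\<boxplus>\<close> 65)
  where "H \<boxplus> V = {(x, y + V x) |x y. (x, y) \<in> H}"

definition resolvent :: "complex \<Rightarrow> 'a::complex_hilbert graph_op \<Rightarrow> 'a \<Rightarrow>\<^sub>L 'a"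
  where "resolvent z H = (THE R::'a \<Rightarrow>\<^sub>L 'a. \<forall>y. (R y, y + z *\<^sub>C R y) \<in> H)"

text \<open>Spectral resolution and bounded functional calculus. \<open>spec_measure E x\<close> is the scalar measure
  \<open>B \<mapsto> \<langle>x, E(B) x\<rangle> = \<parallel>E(B) x\<parallel>\<^sup>2\<close>; by polarization, quadratic forms determine the operators involved.
  Values of \<open>E\<close> outside the Borel sets are normalized to 0 to make \<open>E\<close> unique.\<close>

definition proj_valued_measure :: "(real set \<Rightarrow> ('a::complex_hilbert \<Rightarrow>\<^sub>L 'a)) \<Rightarrow> bool"
  where "proj_valued_measure E \<longleftrightarrow>
    (\<forall>B. B \<notin> sets borel \<longrightarrow> E B = 0) \<and>
    (\<forall>B\<in>sets borel. hermitian (E B) \<and> E B o\<^sub>L E B = E B) \<and>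
    E UNIV = id_blinfun \<and>
    (\<forall>B::nat \<Rightarrow> real set. range B \<subseteq> sets borel \<longrightarrow> disjoint_family B \<longrightarrow>
       (\<forall>x. (\<lambda>n. E (B n) x) sums E (\<Union>n. B n) x))"

definition spec_measure :: "(real set \<Rightarrow> ('a::complex_hilbert \<Rightarrow>\<^sub>L 'a)) \<Rightarrow> 'a \<Rightarrow> real measure"
  where "spec_measure E x = measure_of UNIV (sets borel) (\<lambda>B. ennreal ((norm (E B x))\<^sup>2))"

definition spectral_resolution ::
    "'a::complex_hilbert graph_op \<Rightarrow> real set \<Rightarrow> ('a \<Rightarrow>\<^sub>L 'a)"
  where "spectral_resolution H = (THE E. proj_valued_measure E \<and>
    Domain H = {x. integrable (spec_measure E x) (\<lambda>l. l\<^sup>2)} \<and>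
    (\<forall>(x, y)\<in>H. cinner x y = complex_of_real (\<integral>l. l \<partial>spec_measure E x)))"

definition fun_calc ::
    "(real \<Rightarrow> complex) \<Rightarrow> 'a::complex_hilbert graph_op \<Rightarrow> 'a \<Rightarrow>\<^sub>L 'a"
  where "fun_calc \<phi> H = (THE T::'a \<Rightarrow>\<^sub>L 'a. clin T \<and>
    (\<forall>x. cinner x (T x) = (\<integral>l. \<phi> l \<partial>spec_measure (spectral_resolution H) x)))"

definition ac_subspace :: "'a::complex_hilbert graph_op \<Rightarrow> 'a set"
  where "ac_subspace H =
    {x. absolutely_continuous lborel (spec_measure (spectral_resolution H) x)}"

text \<open>The absolutely continuous spectrum is the spectrum of the part of \<open>H\<close> in its absolutely
  continuous subspace.\<close>

definition resolvent_set_in :: "'a::complex_hilbert set \<Rightarrow> 'a graph_op \<Rightarrow> complex set"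
  where "resolvent_set_in M H = {z.
    (\<forall>y\<in>M. \<exists>!x. (x, y + z *\<^sub>C x) \<in> H) \<and>
    (\<exists>C. \<forall>(x, v)\<in>H. norm x \<le> C * norm (v - z *\<^sub>C x))}"

definition ac_spectrum :: "'a::complex_hilbert graph_op \<Rightarrow> real set"
  where "ac_spectrum H = {l. complex_of_real l \<notin>
    resolvent_set_in (ac_subspace H) (H \<inter> (ac_subspace H \<times> ac_subspace H))}"


section \<open>Trace compatible affine spaces\<close>

definition affine_space ::
    "'a::complex_hilbert graph_op \<Rightarrow> ('a \<Rightarrow>\<^sub>L 'a) set \<Rightarrow> 'a graph_op set"
  where "affine_space H A0 = {H \<boxplus> V |V. V \<in> A0}"

definition Cc_infinity :: "(real \<Rightarrow> complex) \<Rightarrow> bool"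
  where "Cc_infinity \<phi> \<longleftrightarrow> compact (closure {x. \<phi> x \<noteq> 0}) \<and>
    (\<exists>D::nat \<Rightarrow> real \<Rightarrow> complex. D 0 = \<phi> \<and>
       (\<forall>n x. (D n has_vector_derivative D (Suc n) x) (at x)))"

definition locally_convex :: "'a::real_vector set \<Rightarrow> 'a topology \<Rightarrow> bool"
  where "locally_convex A X \<longleftrightarrow> topspace X = A \<and>
    continuous_map (prod_topology X X) X (\<lambda>(u, v). u + v) \<and>
    continuous_map (prod_topology euclideanreal X) X (\<lambda>(r, v). r *\<^sub>R v) \<and>
    (\<forall>U. openin X U \<and> 0 \<in> U \<longrightarrow> (\<exists>C. openin X C \<and> convex C \<and> 0 \<in> C \<and> C \<subseteq> U))"

definition trace_compatible ::
    "'a::complex_hilbert graph_op \<Rightarrow> ('a \<Rightarrow>\<^sub>L 'a) set \<Rightarrow> ('a \<Rightarrow>\<^sub>L 'a) topology \<Rightarrow> bool"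
  where "trace_compatible H A0 X \<longleftrightarrow>
    self_adjoint H \<and> subspace A0 \<and> (\<forall>V\<in>A0. hermitian V) \<and>
    (\<forall>\<phi> V. \<forall>K\<in>affine_space H A0. Cc_infinity \<phi> \<longrightarrow> V \<in> A0 \<longrightarrow>
       schatten 1 (V o\<^sub>L fun_calc \<phi> K)) \<and>
    locally_convex A0 X \<and>
    (\<forall>U. open U \<longrightarrow> openin X (U \<inter> A0)) \<and>
    (\<forall>\<phi>. \<forall>K\<in>affine_space H A0. Cc_infinity \<phi> \<longrightarrow> (\<forall>V1\<in>A0. \<forall>V2\<in>A0.
       ((\<lambda>(U1, U2). schatten_norm 1
           ((U1 o\<^sub>L fun_calc \<phi> (K \<boxplus> U2)) - (V1 o\<^sub>L fun_calc \<phi> (K \<boxplus> V2)))) \<longlongrightarrow> 0)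
         (nhdsin (prod_topology X X) (V1, V2)))) \<and>
    (\<forall>V\<in>A0. \<exists>V1\<in>A0. \<exists>V2\<in>A0. positive_op V1 \<and> positive_op V2 \<and> V = V1 - V2)"


section \<open>Wave and scattering operators\<close>

datatype pm = Pos | Neg

fun time_filter :: "pm \<Rightarrow> real filter"
  where "time_filter Pos = at_top" | "time_filter Neg = at_bot"

definition wave_family ::
    "'a::complex_hilbert graph_op \<Rightarrow> 'a graph_op \<Rightarrow> real \<Rightarrow> 'a \<Rightarrow>\<^sub>L 'a"
  where "wave_family H1 H0 t =
    fun_calc (\<lambda>l. exp (\<i> * t * l)) H1 o\<^sub>L
    fun_calc (\<lambda>l. exp (- (\<i> * t * l))) H0 o\<^sub>L
    orth_proj (ac_subspace H0)"

definition wave_op ::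
    "pm \<Rightarrow> 'a::complex_hilbert graph_op \<Rightarrow> 'a graph_op \<Rightarrow> 'a \<Rightarrow>\<^sub>L 'a"
  where "wave_op s H1 H0 = Blinfun (\<lambda>x. Lim (time_filter s) (\<lambda>t. wave_family H1 H0 t x))"

definition wave_op_complete :: "pm \<Rightarrow> 'a::complex_hilbert graph_op \<Rightarrow> 'a graph_op \<Rightarrow> bool"
  where "wave_op_complete s H1 H0 \<longleftrightarrow>
    (\<forall>x. \<exists>y. ((\<lambda>t. wave_family H1 H0 t x) \<longlongrightarrow> y) (time_filter s)) \<and>
    range (blinfun_apply (wave_op s H1 H0)) = ac_subspace H1"

definition scattering_op ::
    "'a::complex_hilbert graph_op \<Rightarrow> 'a graph_op \<Rightarrow> 'a \<Rightarrow>\<^sub>L 'a"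
  where "scattering_op H1 H0 = adj (wave_op Pos H1 H0) o\<^sub>L wave_op Neg H1 H0"


section \<open>Direct integrals\<close>

text \<open>The fibres \<open>h l\<close> are closed subspaces of one ambient space (for instance \<open>l\<^sup>2\<close>), but the
  measurable structure is that of the fundamental sequence \<open>e\<close> of sections and need not be related to
  this embedding. Elements of the direct integral are pointwise defined sections, which represent
  classes modulo almost everywhere equality.\<close>

definition measurable_field ::
    "real set \<Rightarrow> (real \<Rightarrow> 'f::complex_hilbert set) \<Rightarrow> (nat \<Rightarrow> real \<Rightarrow> 'f) \<Rightarrow> bool"
  where "measurable_field \<sigma> h e \<longleftrightarrow>
    (\<forall>l\<in>\<sigma>. closed_csubspace (h l) \<and> closure (cspan (range (\<lambda>n. e n l))) = h l) \<and>
    (\<forall>m n. (\<lambda>l. cinner (e m l) (e n l)) \<in> borel_measurable (lebesgue_on \<sigma>))"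

definition direct_integral ::
    "real set \<Rightarrow> (real \<Rightarrow> 'f::complex_hilbert set) \<Rightarrow> (nat \<Rightarrow> real \<Rightarrow> 'f) \<Rightarrow> (real \<Rightarrow> 'f) set"
  where "direct_integral \<sigma> h e = {f.
    (\<forall>l\<in>\<sigma>. f l \<in> h l) \<and>
    (\<forall>n. (\<lambda>l. cinner (e n l) (f l)) \<in> borel_measurable (lebesgue_on \<sigma>)) \<and>
    integrable (lebesgue_on \<sigma>) (\<lambda>l. (norm (f l))\<^sup>2)}"

definition diagonalizes ::
    "real set \<Rightarrow> (real \<Rightarrow> 'f::complex_hilbert set) \<Rightarrow> (nat \<Rightarrow> real \<Rightarrow> 'f) \<Rightarrow>
     'a::complex_hilbert graph_op \<Rightarrow> ('a \<Rightarrow> real \<Rightarrow> 'f) \<Rightarrow> bool"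
  where "diagonalizes \<sigma> h e H F \<longleftrightarrow>
    (\<forall>x. F x \<in> direct_integral \<sigma> h e) \<and>
    (\<forall>x y. AE l in lebesgue_on \<sigma>. F (x + y) l = F x l + F y l) \<and>
    (\<forall>c x. AE l in lebesgue_on \<sigma>. F (c *\<^sub>C x) l = c *\<^sub>C F x l) \<and>
    (\<forall>x\<in>ac_subspace H. (\<integral>l. (norm (F x l))\<^sup>2 \<partial>lebesgue_on \<sigma>) = (norm x)\<^sup>2) \<and>
    (\<forall>f\<in>direct_integral \<sigma> h e. \<exists>x\<in>ac_subspace H. AE l in lebesgue_on \<sigma>. F x l = f l) \<and>
    (\<forall>x. (\<forall>y\<in>ac_subspace H. cinner y x = 0) \<longrightarrow> (AE l in lebesgue_on \<sigma>. F x l = 0)) \<and>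
    (\<forall>(x, y)\<in>H. x \<in> ac_subspace H \<longrightarrow> (AE l in lebesgue_on \<sigma>. F y l = l *\<^sub>R F x l))"


section \<open>Limiting absorption\<close>

text \<open>One factorization \<open>V = G* J G\<close> is chosen for every perturbation \<open>V\<close>, in such a way that
  \<open>r V\<close> is factored as \<open>G* (r J) G\<close>. (This is meaningful only for nonzero \<open>r V\<close>, since \<open>J\<close> has to be
  invertible.)\<close>

definition factorization ::
    "('a::complex_hilbert \<Rightarrow>\<^sub>L 'a) set \<Rightarrow> (('a \<Rightarrow>\<^sub>L 'a) \<Rightarrow> ('a \<Rightarrow>\<^sub>L 'k::complex_hilbert)) \<Rightarrow>
     (('a \<Rightarrow>\<^sub>L 'a) \<Rightarrow> ('k \<Rightarrow>\<^sub>L 'k)) \<Rightarrow> bool"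
  where "factorization A0 G J \<longleftrightarrow>
    (\<forall>V\<in>A0. clin (G V) \<and> hermitian (J V) \<and> invertible_op (J V) \<and>
       V = adj (G V) o\<^sub>L J V o\<^sub>L G V) \<and>
    (\<forall>V\<in>A0. \<forall>r. V \<noteq> 0 \<longrightarrow> r \<noteq> 0 \<longrightarrow> G (r *\<^sub>R V) = G V \<and> J (r *\<^sub>R V) = r *\<^sub>R J V)"

definition sandwiched_resolvent ::
    "'a::complex_hilbert graph_op \<Rightarrow> ('a \<Rightarrow>\<^sub>L 'k::complex_hilbert) \<Rightarrow> complex \<Rightarrow> 'k \<Rightarrow>\<^sub>L 'k"
  where "sandwiched_resolvent H G z = G o\<^sub>L resolvent z H o\<^sub>L adj G"

fun pm_sign :: "pm \<Rightarrow> real"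
  where "pm_sign Pos = 1" | "pm_sign Neg = -1"

definition cone :: "pm \<Rightarrow> real \<Rightarrow> real \<Rightarrow> complex set"
  where "cone s c l = {z. 0 < pm_sign s * Im z \<and> \<bar>Re z - l\<bar> \<le> c * \<bar>Im z\<bar>}"

text \<open>\<open>T(l \<plusminus> i0)\<close> is defined here as a non-tangential limit in operator norm; the convergence in the
  stronger Schatten norm is required by \<open>limiting_absorption\<close>.\<close>

definition boundary_value ::
    "pm \<Rightarrow> real \<Rightarrow> 'a::complex_hilbert graph_op \<Rightarrow> ('a \<Rightarrow>\<^sub>L 'k::complex_hilbert) \<Rightarrow> 'k \<Rightarrow>\<^sub>L 'k"
  where "boundary_value s l H G = (THE T. \<forall>c>0.
    (sandwiched_resolvent H G \<longlongrightarrow> T) (at (complex_of_real l) within cone s c l))"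

definition limiting_absorption ::
    "'a::complex_hilbert graph_op set \<Rightarrow> ('a \<Rightarrow>\<^sub>L 'a) set \<Rightarrow>
     (('a \<Rightarrow>\<^sub>L 'a) \<Rightarrow> ('a \<Rightarrow>\<^sub>L 'k::complex_hilbert)) \<Rightarrow> real set \<Rightarrow> bool"
  where "limiting_absorption A A0 G \<Lambda> \<longleftrightarrow>
    (\<exists>p\<ge>1. \<forall>H\<in>A. \<forall>V\<in>A0.
       (\<forall>z. Im z \<noteq> 0 \<longrightarrow> schatten p (sandwiched_resolvent H (G V) z)) \<and>
       (\<forall>l\<in>\<Lambda>. \<forall>s. schatten p (boundary_value s l H (G V)) \<and>
          (\<forall>c>0. ((\<lambda>z. schatten_norm p
              (sandwiched_resolvent H (G V) z - boundary_value s l H (G V))) \<longlongrightarrow> 0)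
            (at (complex_of_real l) within cone s c l)))) \<and>
    (\<forall>H\<in>A. \<forall>V\<in>A0. \<forall>l\<in>\<Lambda>. \<forall>s. schatten 1 (Im_op (boundary_value s l H (G V))))"


section \<open>Pointwise objects\<close>

definition Z_op ::
    "('a::complex_hilbert \<Rightarrow> real \<Rightarrow> 'f::complex_hilbert) \<Rightarrow> real \<Rightarrow>
     ('a \<Rightarrow>\<^sub>L 'k::complex_hilbert) \<Rightarrow> 'k \<Rightarrow>\<^sub>L 'f"
  where "Z_op F l G = Blinfun (\<lambda>\<eta>. F (adj G \<eta>) l)"

definition infinitesimal_scattering ::
    "('a::complex_hilbert \<Rightarrow> real \<Rightarrow> 'f::complex_hilbert) \<Rightarrow> real \<Rightarrow>
     ('a \<Rightarrow>\<^sub>L 'k::complex_hilbert) \<Rightarrow> ('k \<Rightarrow>\<^sub>L 'k) \<Rightarrow> 'f \<Rightarrow>\<^sub>L 'f"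
  where "infinitesimal_scattering F l G J = Z_op F l G o\<^sub>L J o\<^sub>L adj (Z_op F l G)"


section \<open>Paths and the chronological exponential\<close>

definition partition01 :: "nat \<Rightarrow> (nat \<Rightarrow> real) \<Rightarrow> bool"
  where "partition01 n t \<longleftrightarrow> t 0 = 0 \<and> t n = 1 \<and> (\<forall>i<n. t i < t (Suc i))"

definition piecewise_linear_path :: "'a::real_vector set \<Rightarrow> (real \<Rightarrow> 'a) \<Rightarrow> bool"
  where "piecewise_linear_path A W \<longleftrightarrow> (\<forall>r\<in>{0..1}. W r \<in> A) \<and>
    (\<exists>n t. partition01 n t \<and>
       (\<forall>i<n. \<exists>V\<in>A. \<forall>r\<in>{t i..t (Suc i)}. W r = W (t i) + (r - t i) *\<^sub>R V))"

text \<open>On each closed piece the path has to agree, except at the end points, with an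
  \<open>\<SS>\<^sub>1\<close>-continuous path; the values at the partition points are arbitrary.\<close>

definition piecewise_continuous_S1 :: "(real \<Rightarrow> ('f::complex_hilbert \<Rightarrow>\<^sub>L 'f)) \<Rightarrow> bool"
  where "piecewise_continuous_S1 A \<longleftrightarrow> (\<exists>n t. partition01 n t \<and>
    (\<forall>i<n. \<exists>B.
       (\<forall>r\<in>{t i<..<t (Suc i)}. A r = B r) \<and>
       (\<forall>r\<in>{t i..t (Suc i)}. schatten 1 (B r) \<and> hermitian (B r) \<and>
          ((\<lambda>s. schatten_norm 1 (B s - B r)) \<longlongrightarrow> 0) (at r within {t i..t (Suc i)}))))"

text \<open>\<open>iterated_integral A k B t\<close> is
  \<open>\<integral>\<^sub>0\<^sup>t dt\<^sub>1 \<integral>\<^sub>0\<^bsup>t\<^sub>1\<^esup> dt\<^sub>2 \<dots> \<integral>\<^sub>0\<^bsup>t\<^sub>k\<^sub>-\<^sub>1\<^esup> dt\<^sub>k B A(t\<^sub>1) \<dots> A(t\<^sub>k)\<close>.\<close>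

primrec iterated_integral ::
    "(real \<Rightarrow> ('f::complex_hilbert \<Rightarrow>\<^sub>L 'f)) \<Rightarrow> nat \<Rightarrow> ('f \<Rightarrow>\<^sub>L 'f) \<Rightarrow> real \<Rightarrow> 'f \<Rightarrow>\<^sub>L 'f"
  where "iterated_integral A 0 B t = B"
  | "iterated_integral A (Suc k) B t =
       integral {0..t} (\<lambda>s. iterated_integral A k (B o\<^sub>L A s) s)"

text \<open>\<open>Texp E A\<close> is \<open>T exp (-2\<pi>i \<integral>\<^sub>0\<^sup>1 A(s) ds)\<close> for operators on a closed subspace with identity
  operator \<open>E\<close>.\<close>

definition Texp ::
    "('f::complex_hilbert \<Rightarrow>\<^sub>L 'f) \<Rightarrow> (real \<Rightarrow> ('f \<Rightarrow>\<^sub>L 'f)) \<Rightarrow> 'f \<Rightarrow>\<^sub>L 'f"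
  where "Texp E A =
    E + (\<Sum>k. ((- 2 * complex_of_real pi * \<i>) ^ Suc k) *\<^sub>O iterated_integral A (Suc k) E 1)"

end

theory Submission
  imports Defs
begin

text \<open>Along a path \<open>H\<^sub>r\<close> the scattering matrix \<open>U(r) = S(H\<^sub>r, H\<^sub>0)\<close> solves the linear differential equation
  \<open>U' = - 2 \<pi> i \<Phi> U\<close>, \<open>U(0) = 1\<close>, whose coefficient \<open>\<Phi>\<close> is the infinitesimal scattering matrix
  transported to the fibre of \<open>H\<^sub>0\<close>. The chronological exponential is the Picard series of this
  equation.

  For the differential equation it suffices to consider a line \<open>H\<^sub>s = K + s V\<close> with \<open>V = G\<^sup>* J G\<close>. Let
  \<open>T\<close> and \<open>T\<^sub>s\<close> be the boundary values of \<open>G (H - z)\<^sup>-\<^sup>1 G\<^sup>*\<close> at \<open>l + i0\<close> for \<open>K\<close> and \<open>H\<^sub>s\<close>. The second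
  resolvent identity passes to the limit (\<open>boundary_value_resolvent_identity\<close>) and shows that
  \<open>M = 1 - s T\<^sub>s J\<close> and \<open>L = 1 - s J T\<^sub>s\<close> invert \<open>1 + s T J\<close> and \<open>1 + s J T\<close>. By the stationary formula
  \<open>S(H\<^sub>s, K) = 1 - 2 \<pi> i s Z J M Z\<^sup>*\<close>, the scattering matrix has the derivative \<open>- 2 \<pi> i Z J M\<^sup>2 Z\<^sup>*\<close>. By the
  formula for the wave matrices the infinitesimal scattering matrix at \<open>H\<^sub>s\<close>, transported to the fibre
  of \<open>K\<close>, is \<open>Z L J L\<^sup>* Z\<^sup>*\<close>, and \<open>L J = J M\<close>. The relation \<open>2 \<pi> i Z\<^sup>* Z = T - T\<^sup>*\<close> is what makes the two
  expressions fit together: \<open>Z L J L\<^sup>* Z\<^sup>* S(H\<^sub>s, K) = Z J M\<^sup>2 Z\<^sup>*\<close> (\<open>rate_scat\<close>). The chain rule for the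
  wave matrices then replaces the base point \<open>K\<close> by \<open>H\<^sub>0\<close> (\<open>scattering_along_line\<close>). The lines with
  \<open>V = 0\<close>, for which the factorization need not be homogeneous, contribute nothing
  (\<open>rate_zero_perturbation\<close>).

  Trace class continuity of \<open>\<Phi>\<close> follows from its form \<open>C Y(s) C\<^sup>*\<close> with \<open>C\<close> Hilbert-Schmidt and \<open>Y\<close> norm
  continuous (\<open>schatten_norm_1_sandwich_le\<close>). Finally \<open>Texp_eq_ode_solution\<close> identifies the solution of
  the differential equation with the chronological exponential; since \<open>\<Phi>\<close> is bounded, the remainder
  of the Picard series after \<open>n\<close> terms is \<open>O(a\<^sup>n / n!)\<close> for a constant \<open>a\<close>.\<close>

section \<open>Complex Hilbert spaces and adjoints\<close>

instance complex_hilbert \<subseteq> banach ..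

lemma cinner_add_left: "cinner (x + y) z = cinner x z + cinner y (z::'a::complex_hilbert)"
  by (metis cinner_add_right cinner_commute complex_cnj_add)

lemma cinner_scaleC_left: "cinner (c *\<^sub>C x) y = cnj c * cinner x (y::'a::complex_hilbert)"
  by (metis cinner_scaleC_right cinner_commute complex_cnj_mult)

lemma cinner_zero_right [simp]: "cinner x (0::'a::complex_hilbert) = 0"
  using cinner_add_right[of x 0 0] by simp

lemma cinner_zero_left [simp]: "cinner (0::'a::complex_hilbert) x = 0"
  using cinner_add_left[of 0 0 x] by simp

lemma cinner_minus_right: "cinner x (- y) = - cinner x (y::'a::complex_hilbert)"
  using cinner_add_right[of x y "- y"] by (simp add: eq_neg_iff_add_eq_0 add.commute)

lemma cinner_diff_right: "cinner x (y - z) = cinner x y - cinner x (z::'a::complex_hilbert)"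
  by (metis cinner_add_right cinner_minus_right diff_conv_add_uminus)

lemma cinner_diff_left: "cinner (x - y) z = cinner x z - cinner y (z::'a::complex_hilbert)"
  by (metis cinner_diff_right cinner_commute complex_cnj_diff)

lemma cinner_scaleR_right: "cinner x (r *\<^sub>R y) = of_real r * cinner x (y::'a::complex_hilbert)"
  by (metis cinner_scaleC_right scaleC_of_real)

lemma cinner_scaleR_left: "cinner (r *\<^sub>R x) y = of_real r * cinner x (y::'a::complex_hilbert)"
  by (metis cinner_scaleC_left scaleC_of_real complex_cnj_complex_of_real)

lemma scaleC_zero_right [simp]: "c *\<^sub>C (0::'a::complex_hilbert) = 0"
  using scaleC_add_right[of c 0 0] by simp

lemma scaleC_diff_right: "c *\<^sub>C (x - y) = c *\<^sub>C x - c *\<^sub>C (y::'a::complex_hilbert)"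
  using scaleC_add_right[of c "x - y" y] by simp

lemma scaleC_one [simp]: "1 *\<^sub>C (x::'a::complex_hilbert) = x"
  using scaleC_of_real[of 1 x] by simp

lemma scaleC_zero_left [simp]: "0 *\<^sub>C (x::'a::complex_hilbert) = 0"
  using scaleC_of_real[of 0 x] by simp

lemma scaleC_minus_left: "(- c) *\<^sub>C x = - (c *\<^sub>C (x::'a::complex_hilbert))"
  using scaleC_add_left[of c "- c" x] by (simp add: eq_neg_iff_add_eq_0 add.commute)

lemma scaleC_scaleR: "c *\<^sub>C (r *\<^sub>R x) = r *\<^sub>R (c *\<^sub>C (x::'a::complex_hilbert))"
  by (metis scaleC_of_real scaleC_scaleC mult.commute)

lemma cinner_eqI:
  fixes x y :: "'a::complex_hilbert"
  assumes "\<And>z. cinner z x = cinner z y"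
  shows "x = y"
proof -
  have "cinner (x - y) (x - y) = 0"
    by (simp only: cinner_diff_right[of "x - y" x y] assms) simp
  then have "inner (x - y) (x - y) = 0"
    by (simp add: inner_eq_Re_cinner)
  then show ?thesis by simp
qed

text \<open>Both parts of the complex inner product are real inner products, so the real theory of
  orthogonality carries over.\<close>

lemma cinner_eq_inner:
  "cinner x y = Complex (inner x y) (- inner x (\<i> *\<^sub>C (y::'a::complex_hilbert)))"
  by (rule complex_eqI) (simp_all add: inner_eq_Re_cinner cinner_scaleC_right)

lemma norm_scaleC [simp]: "norm (c *\<^sub>C x) = cmod c * norm (x::'a::complex_hilbert)"
proof -
  have "cnj c * c = complex_of_real ((cmod c)\<^sup>2)"
    by (simp only: complex_norm_square mult.commute)
  then have "cinner (c *\<^sub>C x) (c *\<^sub>C x) = complex_of_real ((cmod c)\<^sup>2) * cinner x x"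
    by (simp add: cinner_scaleC_right cinner_scaleC_left mult_ac)
  then have "(norm (c *\<^sub>C x))\<^sup>2 = (cmod c)\<^sup>2 * (norm x)\<^sup>2"
    by (simp only: power2_norm_eq_inner inner_eq_Re_cinner) simp
  then show ?thesis
    by (metis norm_ge_zero mult_nonneg_nonneg power2_eq_imp_eq power_mult_distrib)
qed

lemma abs_Im_cinner_le: "\<bar>Im (cinner x y)\<bar> \<le> norm x * norm (y::'a::complex_hilbert)"
  using Cauchy_Schwarz_ineq2[of x "\<i> *\<^sub>C y"] by (simp add: cinner_eq_inner)

text \<open>A minimizing sequence for the distance to \<open>M\<close> is Cauchy by the parallelogram law, because the
  midpoints of its terms belong to \<open>M\<close> as well; its limit is the projection.\<close>

lemma orthogonal_projection_exists:
  fixes M :: "'a::{real_inner,complete_space} set"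
  assumes M: "subspace M" "closed M"
  shows "\<exists>y\<in>M. \<forall>z\<in>M. inner z (x - y) = 0"
proof -
  define D where "D = (\<lambda>y. (norm (x - y))\<^sup>2) ` M"
  define d where "d = Inf D"
  have D: "D \<noteq> {}" "bdd_below D"
    using subspace_0[OF M(1)] unfolding D_def by (auto intro!: bdd_belowI2[where m=0])
  have d_le: "d \<le> (norm (x - y))\<^sup>2" if "y \<in> M" for y
    unfolding d_def using that by (intro cInf_lower D) (simp add: D_def)
  have "\<exists>y\<in>M. (norm (x - y))\<^sup>2 < d + 1 / real (Suc n)" for n
    using cInf_lessD[OF D(1), of "d + 1 / real (Suc n)"] by (auto simp: d_def D_def)
  then obtain y where y: "\<And>n. y n \<in> M" "\<And>n. (norm (x - y n))\<^sup>2 < d + 1 / real (Suc n)"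
    by metis
  have par: "(norm (u - v))\<^sup>2 \<le> 2 * (norm (x - u))\<^sup>2 + 2 * (norm (x - v))\<^sup>2 - 4 * d"
    if "u \<in> M" "v \<in> M" for u v
  proof -
    have "(1/2) *\<^sub>R (u + v) \<in> M"
      using that M(1) by (intro subspace_mul subspace_add)
    from d_le[OF this] have "4 * d \<le> (norm (2 *\<^sub>R (x - (1/2) *\<^sub>R (u + v))))\<^sup>2"
      by (simp add: power_mult_distrib)
    also have "2 *\<^sub>R (x - (1/2) *\<^sub>R (u + v)) = (x - u) + (x - v)"
      by (simp add: algebra_simps scaleR_2)
    finally show ?thesis
      by (simp add: power2_norm_eq_inner algebra_simps inner_commute)
  qed
  have "Cauchy y"
  proof (rule metric_CauchyI)
    fix e :: real assume "0 < e"
    obtain N :: nat where N: "4 / e\<^sup>2 < real N" using reals_Archimedean2 by blast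
    then have N0: "0 < real N" using \<open>0 < e\<close> by (smt (verit) divide_pos_pos zero_less_power)
    have "dist (y m) (y n) < e" if "N \<le> m" "N \<le> n" for m n
    proof -
      have *: "1 / real (Suc k) < 1 / real N" if "N \<le> k" for k
        using that N0 by (intro divide_strict_left_mono) auto
      have "(norm (y m - y n))\<^sup>2 < 4 / real N"
        using par[OF y(1) y(1), of m n] y(2)[of m] y(2)[of n] *[OF that(1)] *[OF that(2)] by simp
      also have "\<dots> < e\<^sup>2" using N N0 \<open>0 < e\<close> by (simp add: field_simps)
      finally show ?thesis
        using \<open>0 < e\<close> by (simp add: dist_norm power_less_imp_less_base)
    qed
    then show "\<exists>N. \<forall>m\<ge>N. \<forall>n\<ge>N. dist (y m) (y n) < e" by blast
  qed
  then obtain p where p: "y \<longlonglongrightarrow> p" using Cauchy_convergent_iff convergent_def by blast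
  have "p \<in> M" using closed_sequentially[OF M(2) _ p] y(1) by blast
  have dp: "(norm (x - p))\<^sup>2 = d"
  proof (rule antisym)
    show "(norm (x - p))\<^sup>2 \<le> d"
    proof (rule LIMSEQ_le)
      show "(\<lambda>n. (norm (x - y n))\<^sup>2) \<longlonglongrightarrow> (norm (x - p))\<^sup>2" by (intro tendsto_intros p)
      show "(\<lambda>n. d + 1 / real (Suc n)) \<longlonglongrightarrow> d"
        using tendsto_add[OF tendsto_const[of d] LIMSEQ_inverse_real_of_nat]
        by (simp add: inverse_eq_divide)
    qed (use y(2) less_imp_le in blast)
  qed (rule d_le[OF \<open>p \<in> M\<close>])
  have "inner z (x - p) = 0" if "z \<in> M" for z
  proof (cases "z = 0")
    case False
    \<comment> \<open>the multiple of \<open>z\<close> that would be the best correction of \<open>p\<close>\<close>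
    define t where "t = inner z (x - p) / inner z z"
    have zz: "inner z z > 0" using False by simp
    have "p + t *\<^sub>R z \<in> M"
      using that \<open>p \<in> M\<close> M(1) by (intro subspace_add subspace_mul)
    from d_le[OF this] have "(norm (x - p))\<^sup>2 \<le> (norm ((x - p) - t *\<^sub>R z))\<^sup>2"
      by (simp add: dp algebra_simps)
    then have "2 * t * inner z (x - p) \<le> t * t * inner z z"
      by (simp add: power2_norm_eq_inner inner_diff_left inner_diff_right inner_commute algebra_simps)
    then have "inner z (x - p) * inner z (x - p) \<le> 0"
      using zz by (simp add: t_def field_simps)
    then show ?thesis by (auto simp: mult_le_0_iff)
  qed simp
  then show ?thesis using \<open>p \<in> M\<close> by blast
qed

lemma Riesz_representation:
  fixes f :: "'a::{real_inner,complete_space} \<Rightarrow> real"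
  assumes "bounded_linear f"
  shows "\<exists>v. \<forall>x. f x = inner x v"
proof -
  interpret f: bounded_linear f by fact
  show ?thesis
  proof (cases "\<forall>x. f x = 0")
    case False
    then obtain a where a: "f a \<noteq> 0" by blast
    have "subspace {x. f x = 0}"
      by (simp add: subspace_def f.zero f.add f.scaleR)
    moreover have "closed {x. f x = 0}"
      by (intro closed_Collect_eq linear_continuous_on continuous_intros assms)
    ultimately obtain p where p: "f p = 0" "\<And>z. f z = 0 \<Longrightarrow> inner z (a - p) = 0"
      using orthogonal_projection_exists[of "{x. f x = 0}" a] by auto
    \<comment> \<open>\<open>b\<close> spans the orthogonal complement of the kernel\<close>
    define b where "b = a - p"
    have fb: "f b = f a" by (simp add: b_def f.diff p)
    have bb: "inner b b \<noteq> 0" using fb a f.zero by auto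
    have "f x = inner x ((f a / inner b b) *\<^sub>R b)" for x
    proof -
      have "inner (x - (f x / f a) *\<^sub>R b) b = 0"
        using p(2)[of "x - (f x / f a) *\<^sub>R b"] a by (simp add: f.diff f.scaleR fb flip: b_def)
      then show ?thesis using a bb by (simp add: inner_diff_left field_simps)
    qed
    then show ?thesis by blast
  qed (auto intro: exI[of _ 0])
qed

lemma clin_id [simp]: "clin id_blinfun"
  by (simp add: clin_def)

lemma clin_zero [simp]: "clin 0"
  by (simp add: clin_def)

lemma clin_compose [intro]: "clin S \<Longrightarrow> clin T \<Longrightarrow> clin (S o\<^sub>L T)"
  by (simp add: clin_def)

lemma clin_add [intro]: "clin S \<Longrightarrow> clin T \<Longrightarrow> clin (S + T)"
  by (simp add: clin_def blinfun.add_left scaleC_add_right)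

lemma clin_diff [intro]: "clin S \<Longrightarrow> clin T \<Longrightarrow> clin (S - T)"
  by (simp add: clin_def blinfun.diff_left scaleC_diff_right)

lemma clin_scaleR [intro]: "clin T \<Longrightarrow> clin (r *\<^sub>R T)"
  by (simp add: clin_def blinfun.scaleR_left scaleC_scaleR)

lemma hermitian_imp_clin:
  assumes "hermitian T"
  shows "clin T"
  unfolding clin_def
proof (intro allI cinner_eqI)
  fix c x z
  have T: "cinner (T u) v = cinner u (T v)" for u v
    using assms by (simp add: hermitian_def)
  show "cinner z (T (c *\<^sub>C x)) = cinner z (c *\<^sub>C T x)"
    by (simp add: T[symmetric] cinner_scaleC_right)
qed

text \<open>Boundedness of the adjoint comes from
  \<open>\<parallel>R y\<parallel>\<^sup>2 = \<langle>T (R y), y\<rangle> \<le> \<parallel>T\<parallel> \<parallel>R y\<parallel> \<parallel>y\<parallel>\<close>, and complex linearity of \<open>T\<close> turns the real adjoint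
  relation into the complex one.\<close>

lemma adjoint_exists:
  fixes T :: "'a::complex_hilbert \<Rightarrow>\<^sub>L 'b::complex_hilbert"
  assumes "clin T"
  shows "\<exists>R. clin R \<and> norm R \<le> norm T \<and> (\<forall>x y. cinner (T x) y = cinner x (blinfun_apply R y))"
proof -
  have "\<exists>v. \<forall>x. inner (T x) y = inner x v" for y
    by (intro Riesz_representation bounded_linear_intros)
  then obtain R where R: "inner (T x) y = inner x (R y)" for x y
    by metis
  have R': "cinner (T x) y = cinner x (R y)" for x y
  proof (rule complex_eqI)
    show "Re (cinner (T x) y) = Re (cinner x (R y))"
      using R[of x y] by (simp add: inner_eq_Re_cinner)
    show "Im (cinner (T x) y) = Im (cinner x (R y))"
      using R[of "\<i> *\<^sub>C x" y] assms
      by (simp add: inner_eq_Re_cinner clin_def cinner_scaleC_left)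
  qed
  have bound: "norm (R y) \<le> norm y * norm T" for y
  proof (cases "R y = 0")
    case False
    have "norm (R y) * norm (R y) = inner (T (R y)) y"
      by (simp add: R power2_norm_eq_inner flip: power2_eq_square)
    also have "\<dots> \<le> norm (T (R y)) * norm y" by (rule norm_cauchy_schwarz)
    also have "\<dots> \<le> (norm T * norm (R y)) * norm y"
      by (intro mult_right_mono norm_blinfun) simp
    finally have "norm (R y) * norm (R y) \<le> norm (R y) * (norm y * norm T)"
      by (simp add: mult_ac)
    then show ?thesis using False by (subst (asm) mult_le_cancel_left_pos) auto
  qed (simp add: mult_nonneg_nonneg)
  have R_add: "R (x + y) = R x + R y" for x y
    by (rule cinner_eqI) (simp add: cinner_add_right flip: R')
  have R_scale: "R (c *\<^sub>C x) = c *\<^sub>C R x" for c x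
    by (rule cinner_eqI) (simp add: cinner_scaleC_right flip: R')
  have "bounded_linear R"
    by (rule bounded_linear_intro[where K = "norm T"])
      (use R_add R_scale bound in \<open>auto simp flip: scaleC_of_real\<close>)
  then have app: "blinfun_apply (Blinfun R) = R" by (rule bounded_linear_Blinfun_apply)
  have "norm (Blinfun R) \<le> norm T"
    by (rule norm_blinfun_bound) (use bound in \<open>simp_all add: app mult.commute\<close>)
  then show ?thesis
    by (intro exI[of _ "Blinfun R"]) (simp add: app clin_def R_scale R')
qed

lemma adjI:
  assumes "\<And>x y. cinner (blinfun_apply T x) y = cinner x (blinfun_apply R y)"
  shows "adj T = R"
  unfolding adj_def
proof (rule the_equality)
  fix R' assume "\<forall>x y. cinner (T x) y = cinner x (blinfun_apply R' y)"
  then show "R' = R"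
    by (intro blinfun_eqI cinner_eqI) (simp flip: assms)
qed (use assms in simp)

lemma
  assumes "clin T"
  shows cinner_adj: "cinner (T x) y = cinner x (adj T y)"
    and clin_adj [intro]: "clin (adj T)"
    and norm_adj_le: "norm (adj T) \<le> norm T"
  using adjoint_exists[OF assms] adjI by metis+

lemma cinner_adj': "clin T \<Longrightarrow> cinner (adj T x) y = cinner x (T y)"
  by (metis cinner_adj cinner_commute)

lemma adj_adj: "clin T \<Longrightarrow> adj (adj T) = T"
  by (rule adjI) (simp add: cinner_adj')

lemma adj_id [simp]: "adj id_blinfun = id_blinfun"
  by (rule adjI) simp

lemma adj_compose: "clin S \<Longrightarrow> clin T \<Longrightarrow> adj (S o\<^sub>L T) = adj T o\<^sub>L adj S"
  by (rule adjI) (simp add: cinner_adj)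

lemma adj_diff: "clin S \<Longrightarrow> clin T \<Longrightarrow> adj (S - T) = adj S - adj T"
  by (rule adjI) (simp add: cinner_adj blinfun.diff_left cinner_diff_left cinner_diff_right)

lemma adj_add: "clin S \<Longrightarrow> clin T \<Longrightarrow> adj (S + T) = adj S + adj T"
  by (rule adjI) (simp add: cinner_adj blinfun.add_left cinner_add_left cinner_add_right)

lemma adj_scaleR: "clin T \<Longrightarrow> adj (r *\<^sub>R T) = r *\<^sub>R adj T"
  by (rule adjI) (simp add: cinner_adj blinfun.scaleR_left cinner_scaleR_left cinner_scaleR_right)

lemma hermitian_iff_adj: "hermitian T \<longleftrightarrow> clin T \<and> adj T = T"
  using adjI cinner_adj hermitian_imp_clin unfolding hermitian_def by metis

lemma adj_tendsto:
  assumes "\<And>r. clin (f r)" "clin L" "(f \<longlongrightarrow> L) X"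
  shows "((\<lambda>r. adj (f r)) \<longlongrightarrow> adj L) X"
proof -
  have "norm (adj (f r) - adj L) \<le> norm (f r - L)" for r
    using norm_adj_le[of "f r - L"] assms by (simp add: adj_diff clin_diff)
  moreover have "((\<lambda>r. norm (f r - L)) \<longlongrightarrow> 0) X"
    using assms(3) by (simp add: tendsto_norm_zero_iff LIM_zero_iff)
  ultimately have "((\<lambda>r. adj (f r) - adj L) \<longlongrightarrow> 0) X"
    by (intro Lim_null_comparison[of "\<lambda>r. adj (f r) - adj L"]) auto
  then show ?thesis by (simp add: LIM_zero_iff)
qed

text \<open>Multiplication by a complex scalar is composition with a scalar operator, which makes it a
  bounded linear operation on operators.\<close>

lemma bounded_linear_scaleC: "bounded_linear (\<lambda>x::'a::complex_hilbert. c *\<^sub>C x)"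
  by (rule bounded_linear_intro[where K = "cmod c"])
    (simp_all add: scaleC_add_right scaleC_scaleR mult.commute)

lemma scale_op_apply [simp]: "(c *\<^sub>O T) x = c *\<^sub>C T x"
proof -
  have "bounded_linear (\<lambda>x. c *\<^sub>C blinfun_apply T x)"
    by (intro bounded_linear_compose[OF bounded_linear_scaleC] blinfun.bounded_linear_right)
  then show ?thesis by (simp add: scale_op_def bounded_linear_Blinfun_apply)
qed

lemma scale_op_eq_compose: "c *\<^sub>O T = (c *\<^sub>O id_blinfun) o\<^sub>L T"
  by (rule blinfun_eqI) simp

lemma bounded_linear_scale_op: "bounded_linear (\<lambda>T. c *\<^sub>O T)"
  by (subst scale_op_eq_compose)
    (rule bounded_bilinear.bounded_linear_right[OF bounded_bilinear_blinfun_compose])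

lemma norm_scale_op_le: "norm (c *\<^sub>O T) \<le> cmod c * norm T"
  by (rule norm_blinfun_bound) (simp_all add: mult.assoc mult_left_mono norm_blinfun)

lemma compose_scale_op: "clin S \<Longrightarrow> S o\<^sub>L (c *\<^sub>O T) = c *\<^sub>O (S o\<^sub>L T)"
  by (rule blinfun_eqI) (simp add: clin_def)

lemma scale_op_compose: "(c *\<^sub>O S) o\<^sub>L T = c *\<^sub>O (S o\<^sub>L T)"
  by (rule blinfun_eqI) simp

lemma scale_op_scale_op: "c *\<^sub>O (d *\<^sub>O T) = (c * d) *\<^sub>O T"
  by (rule blinfun_eqI) (simp add: scaleC_scaleC)

lemma scale_op_scaleR: "c *\<^sub>O (r *\<^sub>R T) = r *\<^sub>R (c *\<^sub>O T)"
  by (rule blinfun_eqI) (simp add: blinfun.scaleR_left scaleC_scaleR)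

lemma blinfun_compose_assoc: "(R o\<^sub>L S) o\<^sub>L T = R o\<^sub>L (S o\<^sub>L T)"
  by (rule blinfun_eqI) simp

lemma id_compose [simp]: "id_blinfun o\<^sub>L T = T" "T o\<^sub>L id_blinfun = T"
  by (rule blinfun_eqI, simp)+

lemmas compose_simps = blinfun_compose_assoc
  bounded_bilinear.add_left[OF bounded_bilinear_blinfun_compose]
  bounded_bilinear.add_right[OF bounded_bilinear_blinfun_compose]
  bounded_bilinear.diff_left[OF bounded_bilinear_blinfun_compose]
  bounded_bilinear.diff_right[OF bounded_bilinear_blinfun_compose]
  bounded_bilinear.scaleR_left[OF bounded_bilinear_blinfun_compose]
  bounded_bilinear.scaleR_right[OF bounded_bilinear_blinfun_compose]

lemma inv_opI: "X o\<^sub>L R = id_blinfun \<Longrightarrow> R o\<^sub>L X = id_blinfun \<Longrightarrow> inv_op X = R"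
  unfolding inv_op_def by (rule the_equality) (auto, metis blinfun_compose_assoc id_compose)

section \<open>Singular numbers and Schatten classes\<close>

lemma rank_le_zero: "rank_le 0 0"
  unfolding rank_le_def by (intro exI[of _ "{}"]) (auto simp: cspan_def)

lemma rank_le_mono: "rank_le m R \<Longrightarrow> m \<le> n \<Longrightarrow> rank_le n R"
  unfolding rank_le_def using le_trans by blast

lemma rank_le_0_iff: "rank_le 0 R \<longleftrightarrow> R = 0"
proof
  assume "rank_le 0 R"
  then have "range (blinfun_apply R) \<subseteq> {0}"
    by (auto simp: rank_le_def cspan_def)
  then show "R = 0" by (intro blinfun_eqI) auto
qed (simp add: rank_le_zero)

lemma rank_le_add:
  assumes "rank_le m R" "rank_le n Q"
  shows "rank_le (m + n) (R + Q)"
proof -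
  obtain X Y where X: "finite X" "card X \<le> m" "range (blinfun_apply R) \<subseteq> cspan X"
    and Y: "finite Y" "card Y \<le> n" "range (blinfun_apply Q) \<subseteq> cspan Y"
    using assms by (auto simp: rank_le_def)
  have "cspan X \<subseteq> cspan (X \<union> Y)" "cspan Y \<subseteq> cspan (X \<union> Y)"
    unfolding cspan_def by (intro span_mono; blast)+
  then have "R x + Q x \<in> cspan (X \<union> Y)" for x
    using X(3) Y(3) span_add[of "R x" _ "Q x"] unfolding cspan_def by blast
  moreover have "card (X \<union> Y) \<le> m + n"
    using card_Un_le[of X Y] X(2) Y(2) by linarith
  ultimately show ?thesis
    unfolding rank_le_def using X(1) Y(1)
    by (intro exI[of _ "X \<union> Y"]) (auto simp: blinfun.add_left)
qed

lemma rank_le_compose_right: "rank_le n R \<Longrightarrow> rank_le n (R o\<^sub>L T)"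
  unfolding rank_le_def by force

lemma clin_image_cspan:
  assumes "clin T"
  shows "blinfun_apply T ` cspan X = cspan (blinfun_apply T ` X)"
proof -
  have "(\<lambda>x. \<i> *\<^sub>C x) ` blinfun_apply T ` X = blinfun_apply T ` (\<lambda>x. \<i> *\<^sub>C x) ` X"
    using assms by (simp add: image_image clin_def)
  then show ?thesis
    unfolding cspan_def
    using span_linear_image[OF bounded_linear.linear[OF blinfun.bounded_linear_right],
        of T "X \<union> (\<lambda>x. \<i> *\<^sub>C x) ` X"]
    by (simp add: image_Un)
qed

lemma rank_le_compose_left:
  assumes "clin T" "rank_le n R"
  shows "rank_le n (T o\<^sub>L R)"
proof -
  obtain X where X: "finite X" "card X \<le> n" "range (blinfun_apply R) \<subseteq> cspan X"
    using assms by (auto simp: rank_le_def)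
  have "range (blinfun_apply (T o\<^sub>L R)) \<subseteq> blinfun_apply T ` cspan X"
    using X(3) by auto
  then show ?thesis
    unfolding rank_le_def using X(1,2) card_image_le[OF X(1), of "blinfun_apply T"]
    by (intro exI[of _ "blinfun_apply T ` X"]) (auto simp: clin_image_cspan[OF assms(1)])
qed

lemma orthogonal_projection_span_finite:
  fixes B :: "'a::real_inner set"
  assumes "finite B"
  shows "\<exists>y\<in>span B. \<forall>z\<in>span B. inner z (x - y) = 0"
proof -
  obtain C where C: "finite C" "span C = span B" "pairwise orthogonal C"
    using basis_orthogonal[OF assms] by blast
  define y where "y = (\<Sum>b\<in>C. (inner b x / inner b b) *\<^sub>R b)"
  have "inner c (x - y) = 0" if "c \<in> C" for c
  proof -
    have "inner c y = (\<Sum>b\<in>C. if b = c then inner c x else 0)"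
      unfolding y_def inner_sum_right
      using C(3) that by (intro sum.cong) (auto simp: pairwise_def orthogonal_def inner_commute)
    then show ?thesis using that C(1) by (simp add: inner_diff_right)
  qed
  then have "inner z (x - y) = 0" if "z \<in> span C" for z
    using orthogonal_to_span[OF that, of "x - y"] by (simp add: orthogonal_def inner_commute)
  moreover have "y \<in> span C"
    unfolding y_def by (intro span_sum span_mul span_base)
  ultimately show ?thesis using C(2) by auto
qed

text \<open>If \<open>R\<close> has its range in the span \<open>M\<close> of \<open>X\<close>, then \<open>R\<^sup>* y\<close> only depends on the projection of
  \<open>y\<close> to \<open>M\<close>, so \<open>R\<^sup>*\<close> has its range in the span of \<open>R\<^sup>* X\<close>.\<close>

lemma rank_le_adj:
  assumes "clin R" "rank_le n R"
  shows "rank_le n (adj R)"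
proof -
  obtain X where X: "finite X" "card X \<le> n" "range (blinfun_apply R) \<subseteq> cspan X"
    using assms by (auto simp: rank_le_def)
  have "adj R y \<in> cspan (blinfun_apply (adj R) ` X)" for y
  proof -
    obtain p where p: "p \<in> cspan X" "\<And>z. z \<in> cspan X \<Longrightarrow> inner z (y - p) = 0"
      using orthogonal_projection_span_finite[of "X \<union> (\<lambda>x. \<i> *\<^sub>C x) ` X" y] X(1)
      unfolding cspan_def by auto
    have "inner x (adj R (y - p)) = 0" for x
      using p(2)[of "R x"] X(3) cinner_adj[OF assms(1), of x "y - p"]
      by (auto simp: inner_eq_Re_cinner)
    then have "adj R (y - p) = 0"
      using inner_eq_zero_iff by blast
    then have "adj R y = adj R p" by (simp add: blinfun.diff_right)
    then show ?thesis
      using p(1) clin_image_cspan[OF clin_adj[OF assms(1)], of X] by auto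
  qed
  then show ?thesis
    unfolding rank_le_def using X(1,2) card_image_le[OF X(1), of "blinfun_apply (adj R)"]
    by (intro exI[of _ "blinfun_apply (adj R) ` X"]) auto
qed

lemma sing_num_le: "clin R \<Longrightarrow> rank_le n R \<Longrightarrow> sing_num n T \<le> norm (T - R)"
  unfolding sing_num_def by (intro cInf_lower bdd_belowI[where m=0]) auto

lemma sing_num_greatest:
  assumes "\<And>R. clin R \<Longrightarrow> rank_le n R \<Longrightarrow> c \<le> norm (T - R)"
  shows "c \<le> sing_num n T"
  unfolding sing_num_def
  using assms rank_le_mono[OF rank_le_zero] clin_zero by (intro cInf_greatest) blast+

lemma sing_num_nonneg: "0 \<le> sing_num n T"
  by (rule sing_num_greatest) simp

lemma sing_num_approx:
  assumes "0 < e"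
  obtains R where "clin R" "rank_le n R" "norm (T - R) < sing_num n T + e"
proof (rule ccontr)
  assume "\<not> thesis"
  then have "sing_num n T + e \<le> sing_num n T"
    by (intro sing_num_greatest) (use that not_le in blast)
  then show False using assms by simp
qed

lemma sing_num_mult_greatest:
  assumes "0 \<le> b" and "\<And>R. clin R \<Longrightarrow> rank_le n R \<Longrightarrow> c \<le> norm (T - R) * b"
  shows "c \<le> sing_num n T * b"
proof (cases "b = 0")
  case True
  then show ?thesis using assms(2)[OF clin_zero rank_le_mono[OF rank_le_zero]] by simp
next
  case False
  then have "c / b \<le> sing_num n T"
    using assms by (intro sing_num_greatest) (simp add: divide_le_eq)
  then show ?thesis using assms(1) False by (simp add: divide_le_eq)
qed

lemma sing_num_0: "sing_num 0 T = norm T"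
  using sing_num_le[of 0 0 T] sing_num_greatest[of 0 "norm T" T]
  by (intro antisym) (simp_all add: rank_le_0_iff)

lemma sing_num_antimono: "m \<le> n \<Longrightarrow> sing_num n T \<le> sing_num m T"
  by (intro sing_num_greatest sing_num_le) (auto intro: rank_le_mono)

lemma sing_num_le_norm: "sing_num n T \<le> norm T"
  using sing_num_antimono[of 0 n T] by (simp add: sing_num_0)

text \<open>Subadditivity and submultiplicativity: a sum of approximants of ranks \<open>m\<close> and \<open>n\<close> has rank
  at most \<open>m + n\<close>, and so has \<open>S Q + R (T - Q)\<close>, which differs from \<open>S T\<close> by \<open>(S - R) (T - Q)\<close>.\<close>

lemma sing_num_diff: "sing_num (m + n) (S - T) \<le> sing_num m S + sing_num n T"
proof (rule field_le_epsilon)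
  fix e :: real assume "0 < e"
  then obtain R Q where R: "clin R" "rank_le m R" "norm (S - R) < sing_num m S + e / 2"
    and Q: "clin Q" "rank_le n Q" "norm (T - Q) < sing_num n T + e / 2"
    using sing_num_approx[of "e / 2"] by (metis half_gt_zero)
  have "rank_le n (((-1) *\<^sub>R id_blinfun) o\<^sub>L Q)"
    using Q(2) by (intro rank_le_compose_left clin_scaleR clin_id)
  then have "rank_le (m + n) (R - Q)"
    using rank_le_add[OF R(2), of n "((-1) *\<^sub>R id_blinfun) o\<^sub>L Q"]
    by (simp add: bounded_bilinear.minus_left[OF bounded_bilinear_blinfun_compose])
  then have "sing_num (m + n) (S - T) \<le> norm ((S - T) - (R - Q))"
    using R(1) Q(1) by (intro sing_num_le) auto
  also have "\<dots> \<le> norm (S - R) + norm (T - Q)"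
    using norm_triangle_ineq4[of "S - R" "T - Q"] by (simp add: algebra_simps)
  finally show "sing_num (m + n) (S - T) \<le> sing_num m S + sing_num n T + e"
    using R(3) Q(3) by simp
qed

lemma sing_num_compose:
  assumes "clin S" "clin T"
  shows "sing_num (m + n) (S o\<^sub>L T) \<le> sing_num m S * sing_num n T"
proof -
  have main: "sing_num (m + n) (S o\<^sub>L T) \<le> norm (S - R) * norm (T - Q)"
    if "clin R" "rank_le m R" "clin Q" "rank_le n Q" for R Q
  proof -
    have "rank_le (m + n) ((R o\<^sub>L (T - Q)) + (S o\<^sub>L Q))"
      using that assms by (intro rank_le_add rank_le_compose_right rank_le_compose_left)
    then have "sing_num (m + n) (S o\<^sub>L T) \<le> norm ((S o\<^sub>L T) - ((R o\<^sub>L (T - Q)) + (S o\<^sub>L Q)))"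
      using that assms by (intro sing_num_le) auto
    also have "(S o\<^sub>L T) - ((R o\<^sub>L (T - Q)) + (S o\<^sub>L Q)) = (S - R) o\<^sub>L (T - Q)"
      by (simp add: compose_simps)
    finally show ?thesis using norm_blinfun_compose order_trans by blast
  qed
  have "sing_num (m + n) (S o\<^sub>L T) \<le> sing_num m S * norm (T - Q)"
    if "clin Q" "rank_le n Q" for Q
    using main that assms by (intro sing_num_mult_greatest) auto
  then have "sing_num (m + n) (S o\<^sub>L T) \<le> sing_num n T * sing_num m S"
    by (intro sing_num_mult_greatest sing_num_nonneg) (simp_all add: mult.commute)
  then show ?thesis by (simp add: mult.commute)
qed

lemma sing_num_compose3:
  assumes "clin R" "clin S" "clin T"
  shows "sing_num (m + n) (R o\<^sub>L S o\<^sub>L T) \<le> sing_num m R * norm S * sing_num n T"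
proof -
  have "sing_num (0 + n) (S o\<^sub>L T) \<le> norm S * sing_num n T"
    using sing_num_compose[OF assms(2,3)] sing_num_0 by metis
  then have "sing_num m R * sing_num n (S o\<^sub>L T) \<le> sing_num m R * (norm S * sing_num n T)"
    by (intro mult_left_mono sing_num_nonneg) simp
  moreover have "sing_num (m + n) (R o\<^sub>L (S o\<^sub>L T)) \<le> sing_num m R * sing_num n (S o\<^sub>L T)"
    using assms by (intro sing_num_compose) auto
  ultimately show ?thesis by (simp add: blinfun_compose_assoc mult.assoc)
qed

lemma sing_num_adj_le:
  assumes "clin T"
  shows "sing_num n (adj T) \<le> sing_num n T"
proof (rule sing_num_greatest)
  fix R :: "'a \<Rightarrow>\<^sub>L 'b" assume R: "clin R" "rank_le n R"
  have "sing_num n (adj T) \<le> norm (adj T - adj R)"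
    using R by (intro sing_num_le rank_le_adj clin_adj)
  also have "\<dots> \<le> norm (T - R)"
    using norm_adj_le[of "T - R"] R assms by (simp add: adj_diff clin_diff)
  finally show "sing_num n (adj T) \<le> norm (T - R)" .
qed

text \<open>A decreasing sequence is summable once its even-numbered terms are; this absorbs the doubling of
  indices in the inequalities for sums and products.\<close>

lemma summable_even_terms:
  fixes f g :: "nat \<Rightarrow> real"
  assumes f: "decseq f" "\<And>n. 0 \<le> f n" and g: "summable g" and fg: "\<And>n. f (n + n) \<le> g n"
  shows "summable f" and "suminf f \<le> 2 * suminf g"
proof -
  have g0: "0 \<le> g n" for n using order_trans[OF f(2) fg] .
  have "sum f {..<n + n} \<le> 2 * sum g {..<n}" for n
  proof (induction n)
    case (Suc n)
    have "f (Suc (n + n)) \<le> f (n + n)" using f(1) by (simp add: decseq_Suc_iff)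
    then show ?case using Suc fg[of n] by simp
  qed simp
  moreover have "sum f {..<n} \<le> sum f {..<n + n}" for n
    using f(2) by (intro sum_mono2) auto
  moreover have "sum g {..<n} \<le> suminf g" for n
    using g g0 by (intro sum_le_suminf) auto
  ultimately have *: "sum f {..<n} \<le> 2 * suminf g" for n
    by (meson mult_left_mono order_trans zero_le_numeral)
  show "summable f" using f(2) * by (rule summableI_nonneg_bounded)
  then show "suminf f \<le> 2 * suminf g" using * by (rule suminf_le_const)
qed

lemma decseq_sing_num_powr: "0 \<le> p \<Longrightarrow> decseq (\<lambda>n. sing_num n T powr p)"
  by (intro antimonoI powr_mono2 sing_num_nonneg sing_num_antimono)

lemma schatten_imp_clin: "schatten p T \<Longrightarrow> clin T"
  by (simp add: schatten_def)

text \<open>The norm is the first singular number, hence bounded by the Schatten norm as soon as the series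
  that defines the latter converges. For a difference of operators of the class this follows from
  \<open>s\<^bsub>2n\<^esub>(S - T)\<^sup>q \<le> (s\<^sub>n(S) + s\<^sub>n(T))\<^sup>q \<le> 2\<^sup>q (s\<^sub>n(S)\<^sup>q + s\<^sub>n(T)\<^sup>q)\<close>.\<close>

lemma norm_le_schatten_norm_diff:
  assumes p: "1 \<le> p" and S: "schatten p S" and T: "schatten p T"
  shows "norm (S - T) \<le> schatten_norm p (S - T)"
proof (cases "p = \<infinity>")
  case False
  define q where "q = real_of_ereal p"
  have q: "1 \<le> q" using p False unfolding q_def by (cases p) (auto simp: one_ereal_def)
  have "summable (\<lambda>n. 2 powr q * (sing_num n S powr q + sing_num n T powr q))"
    using S T False by (intro summable_mult summable_add) (simp_all add: schatten_def q_def)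
  moreover have "sing_num (n + n) (S - T) powr q
      \<le> 2 powr q * (sing_num n S powr q + sing_num n T powr q)" for n
  proof -
    define m where "m = max (sing_num n S) (sing_num n T)"
    have m: "0 \<le> m" unfolding m_def by (simp add: sing_num_nonneg le_max_iff_disj)
    have "sing_num (n + n) (S - T) powr q \<le> (2 * m) powr q"
      using sing_num_diff[of n n S T] q by (intro powr_mono2 sing_num_nonneg) (auto simp: m_def)
    also have "\<dots> = 2 powr q * m powr q"
      using m by (simp add: powr_mult)
    also have "m powr q \<le> sing_num n S powr q + sing_num n T powr q"
      by (simp add: m_def max_def)
    finally show ?thesis by simp
  qed
  ultimately have "summable (\<lambda>n. sing_num n (S - T) powr q)"
    using q by (intro summable_even_terms(1)[OF decseq_sing_num_powr _ _]) (assumption | simp)+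
  then have "sing_num 0 (S - T) powr q \<le> (\<Sum>n. sing_num n (S - T) powr q)"
    using sum_le_suminf[of "\<lambda>n. sing_num n (S - T) powr q" "{0}"] by simp
  then have "(norm (S - T) powr q) powr (1 / q) \<le> (\<Sum>n. sing_num n (S - T) powr q) powr (1 / q)"
    using q by (intro powr_mono2) (auto simp: sing_num_0)
  then show ?thesis
    using q False by (simp add: schatten_norm_def powr_powr flip: q_def)
qed (simp add: schatten_norm_def)

lemma schatten_2_compose:
  assumes "clin C" "schatten 2 Z"
  shows "schatten 2 (C o\<^sub>L Z)"
proof -
  have Z: "clin Z" using assms(2) by (rule schatten_imp_clin)
  have "summable (\<lambda>n. (norm C)\<^sup>2 * (sing_num n Z)\<^sup>2)"
    using assms(2) by (intro summable_mult) (simp add: schatten_def sing_num_nonneg flip: powr_numeral)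
  moreover have "(sing_num n (C o\<^sub>L Z))\<^sup>2 \<le> (norm C)\<^sup>2 * (sing_num n Z)\<^sup>2" for n
    using power_mono[OF sing_num_compose[OF assms(1) Z, of 0 n] sing_num_nonneg, of 2]
    by (simp add: sing_num_0 power_mult_distrib)
  ultimately have "summable (\<lambda>n. (sing_num n (C o\<^sub>L Z))\<^sup>2)"
    using summable_comparison_test'[of "\<lambda>n. (norm C)\<^sup>2 * (sing_num n Z)\<^sup>2" 0
        "\<lambda>n. (sing_num n (C o\<^sub>L Z))\<^sup>2"] by simp
  then show ?thesis
    using assms(1) Z by (auto simp: schatten_def sing_num_nonneg simp flip: powr_numeral)
qed

text \<open>A product of two Hilbert-Schmidt operators is trace class, quantitatively. This gives the
  trace class continuity of \<open>s \<mapsto> C Y(s) C\<^sup>*\<close> from the norm continuity of \<open>Y\<close>.\<close>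

lemma
  assumes C: "schatten 2 C" and Y: "clin Y"
  shows schatten_1_sandwich: "schatten 1 (C o\<^sub>L Y o\<^sub>L adj C)"
    and schatten_norm_1_sandwich_le:
      "schatten_norm 1 (C o\<^sub>L Y o\<^sub>L adj C) \<le> 2 * (norm Y * (\<Sum>n. (sing_num n C)\<^sup>2))"
proof -
  have [simp]: "clin C" using C by (rule schatten_imp_clin)
  have sq: "summable (\<lambda>n. (sing_num n C)\<^sup>2)"
    using C by (simp add: schatten_def sing_num_nonneg flip: powr_numeral)
  have le: "sing_num (n + n) (C o\<^sub>L Y o\<^sub>L adj C) \<le> norm Y * (sing_num n C)\<^sup>2" for n
  proof -
    have "sing_num (n + n) (C o\<^sub>L Y o\<^sub>L adj C) \<le> sing_num n C * norm Y * sing_num n (adj C)"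
      using Y by (intro sing_num_compose3) auto
    also have "\<dots> \<le> sing_num n C * norm Y * sing_num n C"
      by (intro mult_left_mono sing_num_adj_le mult_nonneg_nonneg sing_num_nonneg) auto
    finally show ?thesis by (simp add: power2_eq_square mult_ac)
  qed
  have dec: "decseq (\<lambda>n. sing_num n (C o\<^sub>L Y o\<^sub>L adj C))"
    by (intro antimonoI sing_num_antimono)
  note even = summable_even_terms[OF dec sing_num_nonneg summable_mult[OF sq] le]
  have "clin (C o\<^sub>L Y o\<^sub>L adj C)" using Y by (intro clin_compose clin_adj) auto
  then show "schatten 1 (C o\<^sub>L Y o\<^sub>L adj C)"
    using even(1) by (simp add: schatten_def sing_num_nonneg)
  show "schatten_norm 1 (C o\<^sub>L Y o\<^sub>L adj C) \<le> 2 * (norm Y * (\<Sum>n. (sing_num n C)\<^sup>2))"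
    using even suminf_nonneg[OF even(1) sing_num_nonneg] sq
    by (simp add: schatten_norm_def sing_num_nonneg suminf_mult)
qed

section \<open>Resolvents of perturbed self-adjoint operators\<close>

lemma perturb_perturb: "(H \<boxplus> V) \<boxplus> W = H \<boxplus> (V + W)"
  unfolding perturb_def by (force simp: blinfun.add_left add.assoc)

lemma perturb_zero [simp]: "H \<boxplus> 0 = H"
  by (auto simp: perturb_def)

lemma mem_perturb_iff: "(x, y) \<in> H \<boxplus> V \<longleftrightarrow> (x, y - V x) \<in> H"
  unfolding perturb_def by (force intro: exI[of _ "y - V x"])

lemma self_adjoint_perturb:
  assumes "self_adjoint H" "hermitian V"
  shows "self_adjoint (H \<boxplus> V)"
proof -
  have V: "cinner (V x) y = cinner x (V y)" for x y
    using assms(2) by (simp add: hermitian_def)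
  have H: "(x, y) \<in> H \<longleftrightarrow> (\<forall>(u, v)\<in>H. cinner v x = cinner u y)" for x y
  proof -
    have "(x, y) \<in> H \<longleftrightarrow> (x, y) \<in> adj_graph H"
      using assms(1) by (simp add: self_adjoint_def)
    then show ?thesis by (simp add: adj_graph_def)
  qed
  have "Domain (H \<boxplus> V) = Domain H" by (auto simp: perturb_def)
  moreover have "(x, y) \<in> adj_graph (H \<boxplus> V) \<longleftrightarrow> (x, y) \<in> H \<boxplus> V" for x y
  proof -
    have "(x, y) \<in> adj_graph (H \<boxplus> V) \<longleftrightarrow> (\<forall>(u, v)\<in>H. cinner (v + V u) x = cinner u y)"
      unfolding adj_graph_def perturb_def by blast
    then show ?thesis
      unfolding mem_perturb_iff H by (simp add: cinner_add_left V cinner_diff_right eq_diff_eq)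
  qed
  ultimately show ?thesis using assms(1) by (auto simp: self_adjoint_def)
qed

lemma self_adjoint_symmetric:
  "self_adjoint H \<Longrightarrow> (x, y) \<in> H \<Longrightarrow> (u, v) \<in> H \<Longrightarrow> cinner v x = cinner u y"
  unfolding self_adjoint_def adj_graph_def by blast

lemma self_adjointI:
  "self_adjoint H \<Longrightarrow> (\<And>u v. (u, v) \<in> H \<Longrightarrow> cinner v x = cinner u y) \<Longrightarrow> (x, y) \<in> H"
  unfolding self_adjoint_def adj_graph_def by blast

lemma self_adjoint_graph_linear:
  assumes H: "self_adjoint H"
  shows "(0, 0) \<in> H"
    and "(x, y) \<in> H \<Longrightarrow> (u, v) \<in> H \<Longrightarrow> (x + u, y + v) \<in> H"
    and "(x, y) \<in> H \<Longrightarrow> (c *\<^sub>C x, c *\<^sub>C y) \<in> H"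
  using self_adjoint_symmetric[OF H]
  by (auto intro!: self_adjointI[OF H] simp: cinner_add_right cinner_scaleC_right)

lemma cinner_left_tendsto: "y \<longlonglongrightarrow> y' \<Longrightarrow> (\<lambda>n. cinner u (y n)) \<longlonglongrightarrow> cinner u (y'::'a::complex_hilbert)"
  unfolding cinner_eq_inner
  by (intro tendsto_Complex tendsto_intros bounded_linear.tendsto[OF bounded_linear_scaleC])

lemma self_adjoint_graph_closed:
  assumes H: "self_adjoint H" and "\<And>n. (x n, y n) \<in> H" and "x \<longlonglongrightarrow> x'" "y \<longlonglongrightarrow> y'"
  shows "(x', y') \<in> H"
proof (rule self_adjointI[OF H])
  fix u v assume "(u, v) \<in> H"
  then have "cinner v (x n) = cinner u (y n)" for n
    using self_adjoint_symmetric[OF H] assms(2) by blast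
  then show "cinner v x' = cinner u y'"
    using cinner_left_tendsto[OF assms(3), of v] cinner_left_tendsto[OF assms(4), of u]
    by (simp add: LIMSEQ_unique)
qed

text \<open>The basic estimate: \<open>\<langle>x, H x\<rangle>\<close> is real, so the imaginary part of \<open>\<langle>x, (H - z) x\<rangle>\<close> is
  \<open>- Im z \<parallel>x\<parallel>\<^sup>2\<close>.\<close>

lemma self_adjoint_lower_bound:
  assumes H: "self_adjoint H" and xv: "(x, y + z *\<^sub>C x) \<in> H"
  shows "\<bar>Im z\<bar> * norm x \<le> norm y"
proof (cases "x = 0")
  case False
  have xx: "cinner x x = of_real ((norm x)\<^sup>2)"
    by (rule complex_eqI) (use cinner_commute[of x x] in
      \<open>auto simp: power2_norm_eq_inner inner_eq_Re_cinner complex_eq_iff\<close>)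
  have "cinner (y + z *\<^sub>C x) x = cinner x (y + z *\<^sub>C x)"
    using self_adjoint_symmetric[OF H xv xv] .
  then have "Im (cinner x (y + z *\<^sub>C x)) = 0"
    using cinner_commute[of x "y + z *\<^sub>C x"] by (auto simp: complex_eq_iff)
  then have "Im (cinner x y) = - (Im z * (norm x)\<^sup>2)"
    by (simp add: cinner_add_right cinner_scaleC_right xx eq_neg_iff_add_eq_0 del: of_real_power)
  then have "\<bar>Im z\<bar> * (norm x)\<^sup>2 = \<bar>Im (cinner x y)\<bar>"
    by (simp add: abs_mult)
  then have "norm x * (\<bar>Im z\<bar> * norm x) \<le> norm x * norm y"
    using abs_Im_cinner_le[of x y] by (simp add: power2_eq_square mult_ac)
  then show ?thesis using False by simp
qed simp

text \<open>The range of \<open>H - z\<close> is closed by the basic estimate, and a vector orthogonal to it belongs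
  to the kernel of \<open>H - cnj z\<close>, which is zero by the same estimate.\<close>

lemma self_adjoint_surj:
  assumes H: "self_adjoint H" and z: "Im z \<noteq> 0"
  shows "\<exists>x. (x, y + z *\<^sub>C x) \<in> H"
proof -
  define Ran where "Ran = {y. \<exists>x. (x, y + z *\<^sub>C x) \<in> H}"
  note lin = self_adjoint_graph_linear[OF H]
  have RanI: "v - z *\<^sub>C u \<in> Ran" if "(u, v) \<in> H" for u v
    using that unfolding Ran_def by (auto intro!: exI[of _ u])
  have sum: "y + y' \<in> Ran" if y: "y \<in> Ran" and y': "y' \<in> Ran" for y y'
  proof -
    obtain u v where "(u, y + z *\<^sub>C u) \<in> H" "(v, y' + z *\<^sub>C v) \<in> H"
      using y y' unfolding Ran_def by blast
    from RanI[OF lin(2)[OF this]] show ?thesis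
      by (simp add: scaleC_add_right algebra_simps)
  qed
  have scale: "c *\<^sub>C y \<in> Ran" if y: "y \<in> Ran" for c y
  proof -
    obtain u where "(u, y + z *\<^sub>C u) \<in> H"
      using y unfolding Ran_def by blast
    from RanI[OF lin(3)[OF this, of c]] show ?thesis
      by (simp add: scaleC_add_right scaleC_scaleC mult.commute)
  qed
  have "0 \<in> Ran" using RanI[OF lin(1)] by simp
  then have "subspace Ran"
    using sum scale by (auto simp: subspace_def simp flip: scaleC_of_real)
  moreover have "closed Ran"
    unfolding closed_sequential_limits
  proof (intro allI impI)
    fix y l assume yl: "(\<forall>n. y n \<in> Ran) \<and> y \<longlonglongrightarrow> l"
    then obtain x where x: "\<And>n. (x n, y n + z *\<^sub>C x n) \<in> H"
      unfolding Ran_def by simp metis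
    have "Cauchy x"
    proof (rule metric_CauchyI)
      fix e :: real assume "0 < e"
      then have "0 < \<bar>Im z\<bar> * e" using z by simp
      moreover have "Cauchy y" using yl LIMSEQ_imp_Cauchy by blast
      ultimately obtain N where N: "\<And>m n. N \<le> m \<Longrightarrow> N \<le> n \<Longrightarrow> dist (y m) (y n) < \<bar>Im z\<bar> * e"
        unfolding Cauchy_def by metis
      have bound: "\<bar>Im z\<bar> * norm (x m - x n) \<le> norm (y m - y n)" for m n
      proof (rule self_adjoint_lower_bound[OF H])
        have "(x m + (-1) *\<^sub>C x n, (y m + z *\<^sub>C x m) + (-1) *\<^sub>C (y n + z *\<^sub>C x n)) \<in> H"
          using x by (intro lin)
        moreover have "(-1) *\<^sub>C u = - u" for u :: 'a
          using scaleC_of_real[of "-1" u] by simp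
        ultimately show "(x m - x n, (y m - y n) + z *\<^sub>C (x m - x n)) \<in> H"
          by (simp add: scaleC_diff_right algebra_simps)
      qed
      then have "dist (x m) (x n) < e" if "N \<le> m" "N \<le> n" for m n
      proof -
        have "\<bar>Im z\<bar> * dist (x m) (x n) < \<bar>Im z\<bar> * e"
          using N[OF that] bound[of m n] by (simp add: dist_norm)
        then show ?thesis using z by (simp add: mult_less_cancel_left)
      qed
      then show "\<exists>N. \<forall>m\<ge>N. \<forall>n\<ge>N. dist (x m) (x n) < e" by blast
    qed
    then obtain x' where x': "x \<longlonglongrightarrow> x'" using Cauchy_convergent_iff convergent_def by blast
    have "(\<lambda>n. y n + z *\<^sub>C x n) \<longlonglongrightarrow> l + z *\<^sub>C x'"
      using yl by (intro tendsto_add bounded_linear.tendsto[OF bounded_linear_scaleC] x') simp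
    then have "(x', l + z *\<^sub>C x') \<in> H"
      using self_adjoint_graph_closed[OF H x x'] by blast
    then show "l \<in> Ran" unfolding Ran_def by blast
  qed
  ultimately obtain p where p: "p \<in> Ran" "\<And>w. w \<in> Ran \<Longrightarrow> inner w (y - p) = 0"
    using orthogonal_projection_exists by blast
  have orth: "cinner w (y - p) = 0" if "w \<in> Ran" for w
  proof -
    have "inner (\<i> *\<^sub>C w) (y - p) = 0" "inner w (y - p) = 0"
      using p(2) scale that by blast+
    then show ?thesis
      by (intro complex_eqI) (simp_all add: inner_eq_Re_cinner cinner_scaleC_left)
  qed
  have "(y - p, 0 + cnj z *\<^sub>C (y - p)) \<in> H"
  proof (rule self_adjointI[OF H])
    fix u v assume "(u, v) \<in> H"
    then have "cinner (v - z *\<^sub>C u) (y - p) = 0"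
      by (intro orth RanI)
    then show "cinner v (y - p) = cinner u (0 + cnj z *\<^sub>C (y - p))"
      by (simp add: cinner_diff_left cinner_scaleC_left cinner_scaleC_right)
  qed
  then have "\<bar>Im (cnj z)\<bar> * norm (y - p) \<le> norm (0::'a)"
    by (rule self_adjoint_lower_bound[OF H])
  then have "y = p" using z by (simp add: mult_le_0_iff)
  then show ?thesis using p(1) unfolding Ran_def by blast
qed

lemma self_adjoint_unique:
  assumes H: "self_adjoint H" and z: "Im z \<noteq> 0"
    and x: "(x, y + z *\<^sub>C x) \<in> H" and u: "(u, y + z *\<^sub>C u) \<in> H"
  shows "x = u"
proof -
  note lin = self_adjoint_graph_linear[OF H]
  have "(x + (-1) *\<^sub>C u, (y + z *\<^sub>C x) + (-1) *\<^sub>C (y + z *\<^sub>C u)) \<in> H"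
    by (intro lin x u)
  moreover have "(-1) *\<^sub>C v = - v" for v :: 'a
    using scaleC_of_real[of "-1" v] by simp
  ultimately have "(x - u, 0 + z *\<^sub>C (x - u)) \<in> H"
    by (simp add: scaleC_diff_right)
  then have "\<bar>Im z\<bar> * norm (x - u) \<le> norm (0::'a)" by (rule self_adjoint_lower_bound[OF H])
  then show ?thesis using z by (simp add: mult_le_0_iff)
qed

lemma resolvent_graph:
  assumes H: "self_adjoint H" and z: "Im z \<noteq> 0"
  shows "(resolvent z H y, y + z *\<^sub>C resolvent z H y) \<in> H"
proof -
  obtain R where R: "\<And>y. (R y, y + z *\<^sub>C R y) \<in> H"
    using self_adjoint_surj[OF H z] by metis
  note lin = self_adjoint_graph_linear[OF H]
  have "R (x + y) = R x + R y" for x y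
    using lin(2)[OF R R, of x y]
    by (intro self_adjoint_unique[OF H z R]) (simp add: scaleC_add_right algebra_simps)
  moreover have "R (c *\<^sub>C x) = c *\<^sub>C R x" for c x
    using lin(3)[OF R, of c x]
    by (intro self_adjoint_unique[OF H z R])
      (simp add: scaleC_add_right scaleC_scaleC mult.commute)
  moreover have "norm (R x) \<le> norm x * (1 / \<bar>Im z\<bar>)" for x
    using self_adjoint_lower_bound[OF H R[of x]] z by (simp add: field_simps)
  ultimately have "bounded_linear R"
    by (intro bounded_linear_intro[where K = "1 / \<bar>Im z\<bar>"]) (auto simp flip: scaleC_of_real)
  then have R': "(Blinfun R y, y + z *\<^sub>C Blinfun R y) \<in> H" for y
    using R by (simp add: bounded_linear_Blinfun_apply)
  have "resolvent z H = Blinfun R"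
    unfolding resolvent_def
  proof (rule the_equality)
    fix S assume "\<forall>y. (blinfun_apply S y, y + z *\<^sub>C S y) \<in> H"
    then show "S = Blinfun R"
      by (intro blinfun_eqI self_adjoint_unique[OF H z _ R']) blast
  qed (use R' in blast)
  then show ?thesis using R' by simp
qed

text \<open>\<open>(H + V - z) x = y\<close> says that \<open>(H - z) x = y - V x\<close>.\<close>

lemma second_resolvent_identity:
  assumes H: "self_adjoint H" "self_adjoint (H \<boxplus> V)" and z: "Im z \<noteq> 0"
  shows "resolvent z (H \<boxplus> V) = resolvent z H - (resolvent z H o\<^sub>L V o\<^sub>L resolvent z (H \<boxplus> V))"
proof (rule blinfun_eqI)
  fix y
  let ?R = "resolvent z (H \<boxplus> V)"
  have "(?R y, (y - V (?R y)) + z *\<^sub>C ?R y) \<in> H"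
    using resolvent_graph[OF H(2) z, of y] by (simp add: mem_perturb_iff algebra_simps)
  then have "?R y = resolvent z H (y - V (?R y))"
    using self_adjoint_unique[OF H(1) z] resolvent_graph[OF H(1) z] by blast
  then show "?R y = (resolvent z H - (resolvent z H o\<^sub>L V o\<^sub>L ?R)) y"
    by (simp add: blinfun.diff_left blinfun.diff_right)
qed

lemma sandwiched_resolvent_identity:
  assumes "self_adjoint H" "self_adjoint (H \<boxplus> V)" "Im z \<noteq> 0" and V: "V = adj G o\<^sub>L J o\<^sub>L G"
  shows "sandwiched_resolvent (H \<boxplus> V) G z = sandwiched_resolvent H G z
    - (sandwiched_resolvent H G z o\<^sub>L J o\<^sub>L sandwiched_resolvent (H \<boxplus> V) G z)"
proof -
  let ?R = "resolvent z"
  have "G o\<^sub>L ?R (H \<boxplus> V) o\<^sub>L adj G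
      = G o\<^sub>L (?R H - (?R H o\<^sub>L (adj G o\<^sub>L J o\<^sub>L G) o\<^sub>L ?R (H \<boxplus> V))) o\<^sub>L adj G"
    using second_resolvent_identity[OF assms(1-3)] V by simp
  then show ?thesis by (simp add: sandwiched_resolvent_def compose_simps)
qed

lemma at_within_cone_nontrivial: "at (complex_of_real l) within cone Pos 1 l \<noteq> bot"
proof -
  have "(\<lambda>n. Complex l (1 / real (Suc n))) \<longlonglongrightarrow> Complex l 0"
    using LIMSEQ_inverse_real_of_nat
    by (intro tendsto_Complex tendsto_const) (simp add: inverse_eq_divide)
  then have "complex_of_real l islimpt cone Pos 1 l"
    unfolding islimpt_sequential
    by (intro exI[of _ "\<lambda>n. Complex l (1 / real (Suc n))"])
      (auto simp: cone_def complex_of_real_def)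
  then show ?thesis by (simp add: trivial_limit_within)
qed

text \<open>The identity passes to the boundary values, since they are operator norm limits from inside a
  cone.\<close>

lemma boundary_value_resolvent_identity:
  assumes "self_adjoint H" "self_adjoint (H \<boxplus> V)" and V: "V = adj G o\<^sub>L J o\<^sub>L G"
    and lim: "\<And>K. K \<in> {H, H \<boxplus> V} \<Longrightarrow> (sandwiched_resolvent K G \<longlongrightarrow> boundary_value Pos l K G)
      (at (complex_of_real l) within cone Pos 1 l)"
  shows "boundary_value Pos l (H \<boxplus> V) G = boundary_value Pos l H G
    - (boundary_value Pos l H G o\<^sub>L J o\<^sub>L boundary_value Pos l (H \<boxplus> V) G)"
proof (rule tendsto_unique[OF at_within_cone_nontrivial lim])
  have "eventually (\<lambda>z. Im z \<noteq> 0) (at (complex_of_real l) within cone Pos 1 l)"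
    by (auto simp: eventually_at_filter cone_def)
  then have "eventually (\<lambda>z. sandwiched_resolvent (H \<boxplus> V) G z = sandwiched_resolvent H G z
      - (sandwiched_resolvent H G z o\<^sub>L J o\<^sub>L sandwiched_resolvent (H \<boxplus> V) G z))
      (at (complex_of_real l) within cone Pos 1 l)"
    by eventually_elim (rule sandwiched_resolvent_identity[OF assms(1,2) _ V])
  moreover have "((\<lambda>z. sandwiched_resolvent H G z
      - (sandwiched_resolvent H G z o\<^sub>L J o\<^sub>L sandwiched_resolvent (H \<boxplus> V) G z)) \<longlongrightarrow>
      boundary_value Pos l H G
      - (boundary_value Pos l H G o\<^sub>L J o\<^sub>L boundary_value Pos l (H \<boxplus> V) G))
      (at (complex_of_real l) within cone Pos 1 l)"
    by (intro tendsto_diff bounded_bilinear.tendsto[OF bounded_bilinear_blinfun_compose]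
        tendsto_const lim) auto
  ultimately show "(sandwiched_resolvent (H \<boxplus> V) G \<longlongrightarrow> boundary_value Pos l H G
      - (boundary_value Pos l H G o\<^sub>L J o\<^sub>L boundary_value Pos l (H \<boxplus> V) G))
      (at (complex_of_real l) within cone Pos 1 l)"
    by (subst tendsto_cong)
qed simp

text \<open>Limits in a Schatten norm are limits in operator norm.\<close>

lemma limiting_absorption_tendsto:
  assumes "limiting_absorption A A0 G \<Lambda>" "K \<in> A" "V \<in> A0" "l \<in> \<Lambda>"
  shows "(sandwiched_resolvent K (G V) \<longlongrightarrow> boundary_value Pos l K (G V))
    (at (complex_of_real l) within cone Pos 1 l)"
    and "clin (boundary_value Pos l K (G V))"
proof -
  let ?T = "sandwiched_resolvent K (G V)" and ?B = "boundary_value Pos l K (G V)"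
  obtain p where p: "1 \<le> p" "\<And>z. Im z \<noteq> 0 \<Longrightarrow> schatten p (?T z)" "schatten p ?B"
    "((\<lambda>z. schatten_norm p (?T z - ?B)) \<longlongrightarrow> 0) (at (complex_of_real l) within cone Pos 1 l)"
    using assms unfolding limiting_absorption_def by (metis zero_less_one)
  show "clin ?B" using p(3) by (rule schatten_imp_clin)
  have "eventually (\<lambda>z. Im z \<noteq> 0) (at (complex_of_real l) within cone Pos 1 l)"
    by (auto simp: eventually_at_filter cone_def)
  then have "eventually (\<lambda>z. norm (?T z - ?B) \<le> schatten_norm p (?T z - ?B))
      (at (complex_of_real l) within cone Pos 1 l)"
    by eventually_elim (intro norm_le_schatten_norm_diff p)
  then have "((\<lambda>z. ?T z - ?B) \<longlongrightarrow> 0) (at (complex_of_real l) within cone Pos 1 l)"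
    using p(4) by (rule Lim_null_comparison)
  then show "(?T \<longlongrightarrow> ?B) (at (complex_of_real l) within cone Pos 1 l)"
    by (simp add: LIM_zero_iff)
qed

section \<open>The chronological exponential\<close>

lemma partition01_bounds:
  assumes "partition01 n t" "i \<le> n"
  shows "0 \<le> t i" "t i \<le> 1"
proof -
  have "0 \<le> t i" using assms(2)
  proof (induction i)
    case (Suc i)
    then have "0 \<le> t i" "t i < t (Suc i)" using assms(1) by (auto simp: partition01_def)
    then show ?case by simp
  qed (use assms in \<open>simp add: partition01_def\<close>)
  moreover have "t i \<le> 1"
    using assms(2)
  proof (induction rule: inc_induct)
    case (step j)
    then have "t j < t (Suc j)" using assms(1) by (auto simp: partition01_def)
    then show ?case using step by simp
  qed (use assms in \<open>simp add: partition01_def\<close>)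
  ultimately show "0 \<le> t i" "t i \<le> 1" by auto
qed

lemma partition01_induct [consumes 1, case_names zero step]:
  assumes "partition01 n t" and "Q 0"
    and "\<And>i. i < n \<Longrightarrow> 0 \<le> t i \<Longrightarrow> t i < t (Suc i) \<Longrightarrow> t (Suc i) \<le> 1 \<Longrightarrow> Q (t i) \<Longrightarrow> Q (t (Suc i))"
  shows "Q 1"
proof -
  have "i \<le> n \<Longrightarrow> Q (t i)" for i
  proof (induction i)
    case (Suc i)
    then have "Q (t i)" "t i < t (Suc i)" "i < n"
      using assms(1) by (auto simp: partition01_def)
    then show ?case
      using assms(3)[of i] partition01_bounds[OF assms(1), of i]
        partition01_bounds[OF assms(1), of "Suc i"] by auto
  qed (use assms in \<open>simp add: partition01_def\<close>)
  from this[of n] show ?thesis using assms(1) by (simp add: partition01_def)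
qed

lemma partition01_interior:
  assumes "partition01 n t" "r \<in> {0..1}" "r \<notin> t ` {..n}"
  obtains i where "i < n" "r \<in> {t i<..<t (Suc i)}"
proof -
  have "r < t n \<or> r = t n" "t 0 \<le> r"
    using assms by (auto simp: partition01_def)
  then have rn: "r < t n" using assms(3) by auto
  define j where "j = (LEAST j. r < t j)"
  have j: "r < t j" unfolding j_def using rn by (rule LeastI)
  have "j \<le> n" unfolding j_def using rn by (rule Least_le)
  obtain i where i: "j = Suc i" using j \<open>t 0 \<le> r\<close> by (cases j) auto
  then have "\<not> r < t i" using not_less_Least[of i "\<lambda>j. r < t j"] by (simp add: j_def)
  moreover have "r \<noteq> t i" using assms(3) i \<open>j \<le> n\<close> by auto
  ultimately show thesis using that[of i] i j \<open>j \<le> n\<close> by auto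
qed

text \<open>A piecewise continuous path enters the chronological exponential only through its integrals, so
  it is described by what survives a change of its values at finitely many times: products with
  continuous paths are integrable, and outside the finite set \<open>N\<close> the values are complex linear and
  bounded by \<open>M\<close>.\<close>

locale operator_path =
  fixes \<Phi> :: "real \<Rightarrow> 'f::complex_hilbert \<Rightarrow>\<^sub>L 'f" and N :: "real set" and M :: real
  assumes finite_exceptions: "finite N"
    and compose_integrable: "\<And>f :: real \<Rightarrow> 'f \<Rightarrow>\<^sub>L 'f. continuous_on {0..1} f \<Longrightarrow>
      (\<lambda>s. \<Phi> s o\<^sub>L f s) integrable_on {0..1}"
    and norm_le: "\<And>s. s \<in> {0..1} - N \<Longrightarrow> norm (\<Phi> s) \<le> M"
    and clin_path: "\<And>s. s \<in> {0..1} - N \<Longrightarrow> clin (\<Phi> s)"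
begin

lemma compose_integrable_upto:
  fixes f :: "real \<Rightarrow> 'f \<Rightarrow>\<^sub>L 'f"
  assumes "continuous_on {0..1} f" "t \<in> {0..1}"
  shows "(\<lambda>s. \<Phi> s o\<^sub>L f s) integrable_on {0..t}"
  using integrable_on_subinterval[OF compose_integrable[OF assms(1)], of 0 t] assms(2) by auto

text \<open>The terms of the Picard series of \<open>Q' = \<Phi> Q\<close>, \<open>Q(0) = 1\<close>.\<close>

primrec propagator :: "nat \<Rightarrow> real \<Rightarrow> 'f \<Rightarrow>\<^sub>L 'f"
  where "propagator 0 t = id_blinfun"
  | "propagator (Suc k) t = integral {0..t} (\<lambda>s. \<Phi> s o\<^sub>L propagator k s)"

lemma continuous_propagator: "continuous_on {0..1} (propagator k)"
  by (induction k) (auto intro!: indefinite_integral_continuous_1 compose_integrable)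

text \<open>\<open>iterated_integral\<close> accumulates the operator product in its prefactor \<open>B\<close>, beginning with the
  outermost time, while the Picard iteration begins with the innermost one. Both orders of
  evaluation agree because \<open>B\<close> can be pulled out of the integral.\<close>

lemma iterated_integral_eq:
  "t \<in> {0..1} \<Longrightarrow> iterated_integral \<Phi> k B t = B o\<^sub>L propagator k t"
proof (induction k arbitrary: B t)
  case (Suc k)
  have "iterated_integral \<Phi> (Suc k) B t
      = integral {0..t} (\<lambda>s. iterated_integral \<Phi> k (B o\<^sub>L \<Phi> s) s)"
    by simp
  also have "\<dots> = integral {0..t} ((\<lambda>X. B o\<^sub>L X) \<circ> (\<lambda>s. \<Phi> s o\<^sub>L propagator k s))"
    using Suc by (intro integral_cong) (auto simp: compose_simps)
  also have "\<dots> = B o\<^sub>L propagator (Suc k) t"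
    using compose_integrable_upto[OF continuous_propagator Suc.prems]
      bounded_bilinear.bounded_linear_right[OF bounded_bilinear_blinfun_compose]
    by (subst integral_linear) auto
  finally show ?case .
qed simp

text \<open>A left or right identity \<open>E\<close> of \<open>\<Phi>\<close> can be pulled through the integrals, so it is an identity for
  all terms of the Picard series except the first one. This is why the series may be started from \<open>E\<close>
  instead of the identity of the whole space.\<close>

lemma propagator_absorb:
  assumes "\<And>s. s \<in> {0..1} - N \<Longrightarrow> E o\<^sub>L \<Phi> s = \<Phi> s" "\<And>s. s \<in> {0..1} - N \<Longrightarrow> \<Phi> s o\<^sub>L E = \<Phi> s"
    and "t \<in> {0..1}"
  shows "E o\<^sub>L propagator (Suc k) t = propagator (Suc k) t"
    and "propagator (Suc k) t o\<^sub>L E = propagator (Suc k) t"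
proof -
  note int = compose_integrable_upto[OF continuous_propagator]
  have "E o\<^sub>L propagator (Suc k) t = integral {0..t} ((\<lambda>X. E o\<^sub>L X) \<circ> (\<lambda>s. \<Phi> s o\<^sub>L propagator k s))"
    using int[OF assms(3)] bounded_bilinear.bounded_linear_right[OF bounded_bilinear_blinfun_compose]
    by (subst integral_linear) auto
  also have "\<dots> = propagator (Suc k) t"
    unfolding propagator.simps
    using assms by (intro integral_spike[OF negligible_finite[OF finite_exceptions]])
      (auto simp flip: blinfun_compose_assoc)
  finally show "E o\<^sub>L propagator (Suc k) t = propagator (Suc k) t" .
  show "propagator (Suc k) t o\<^sub>L E = propagator (Suc k) t"
    using assms(3)
  proof (induction k arbitrary: t)
    case 0
    have "propagator (Suc 0) t o\<^sub>L E
        = integral {0..t} ((\<lambda>X. X o\<^sub>L E) \<circ> (\<lambda>s. \<Phi> s o\<^sub>L propagator 0 s))"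
      using int[OF 0, of 0] bounded_bilinear.bounded_linear_left[OF bounded_bilinear_blinfun_compose]
      by (subst integral_linear) auto
    also have "\<dots> = propagator (Suc 0) t"
      unfolding propagator.simps
      using assms(2) 0 by (intro integral_spike[OF negligible_finite[OF finite_exceptions]]) auto
    finally show ?case .
  next
    case (Suc k)
    have "propagator (Suc (Suc k)) t o\<^sub>L E
        = integral {0..t} ((\<lambda>X. X o\<^sub>L E) \<circ> (\<lambda>s. \<Phi> s o\<^sub>L propagator (Suc k) s))"
      using int[OF Suc.prems, of "Suc k"]
        bounded_bilinear.bounded_linear_left[OF bounded_bilinear_blinfun_compose]
      by (subst integral_linear) auto
    also have "\<dots> = integral {0..t} (\<lambda>s. \<Phi> s o\<^sub>L propagator (Suc k) s)"
      using Suc by (intro integral_cong) (auto simp: blinfun_compose_assoc simp del: propagator.simps)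
    finally show ?case by simp
  qed
qed

text \<open>Iterating the integral equation \<open>U(t) = U(0) + c \<integral>\<^sub>0\<^sup>t \<Phi> U\<close> subtracts the Picard terms one after
  the other. The remainder is an integral over a simplex of volume \<open>t\<^sup>n / n!\<close>, so it tends to zero.\<close>

lemma ode_solution_sums:
  assumes cont: "continuous_on {0..1} U"
    and deriv: "\<And>s. s \<in> {0<..<1} - N \<Longrightarrow>
      (U has_vector_derivative c *\<^sub>O (\<Phi> s o\<^sub>L U s)) (at s)"
  shows "(\<lambda>k. c ^ k *\<^sub>O (propagator k 1 o\<^sub>L U 0)) sums U 1"
proof -
  define D where "D = (\<lambda>n t. U t - (\<Sum>k<n. c ^ k *\<^sub>O (propagator k t o\<^sub>L U 0)))"
  define a where "a = cmod c * M"
  have cont_D: "continuous_on {0..1} (D n)" for n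
    unfolding D_def
    by (intro continuous_intros cont bounded_linear.continuous_on[OF bounded_linear_scale_op]
        bounded_bilinear.continuous_on[OF bounded_bilinear_blinfun_compose] continuous_propagator)
  have D_Suc: "((\<lambda>s. c *\<^sub>O (\<Phi> s o\<^sub>L D n s)) has_integral D (Suc n) t) {0..t}"
    if t: "t \<in> {0..1}" for n t
  proof -
    have U: "((\<lambda>s. c *\<^sub>O (\<Phi> s o\<^sub>L U s)) has_integral (U t - U 0)) {0..t}"
      by (rule fundamental_theorem_of_calculus_interior_strong[OF finite_exceptions])
        (use t deriv continuous_on_subset[OF cont] in auto)
    have Q: "((\<lambda>s. c *\<^sub>O (\<Phi> s o\<^sub>L (c ^ k *\<^sub>O (propagator k s o\<^sub>L U 0))))
        has_integral (c ^ Suc k *\<^sub>O (propagator (Suc k) t o\<^sub>L U 0))) {0..t}" for k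
    proof -
      have "bounded_linear (\<lambda>X. c ^ Suc k *\<^sub>O (X o\<^sub>L U 0))"
        by (intro bounded_linear_compose[OF bounded_linear_scale_op]
            bounded_bilinear.bounded_linear_left[OF bounded_bilinear_blinfun_compose])
      from has_integral_linear[OF integrable_integral[OF
          compose_integrable_upto[OF continuous_propagator t]] this]
      have *: "((\<lambda>s. c ^ Suc k *\<^sub>O (\<Phi> s o\<^sub>L propagator k s o\<^sub>L U 0))
          has_integral (c ^ Suc k *\<^sub>O (propagator (Suc k) t o\<^sub>L U 0))) {0..t}"
        by (simp add: o_def)
      show ?thesis
      proof (rule has_integral_spike_finite[OF finite_exceptions _ *])
        fix s assume "s \<in> {0..t} - N"
        then show "c *\<^sub>O (\<Phi> s o\<^sub>L (c ^ k *\<^sub>O (propagator k s o\<^sub>L U 0)))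
            = c ^ Suc k *\<^sub>O (\<Phi> s o\<^sub>L propagator k s o\<^sub>L U 0)"
          using t clin_path[of s]
          by (simp add: compose_scale_op scale_op_scale_op blinfun_compose_assoc)
      qed
    qed
    have lin: "bounded_linear (\<lambda>X. c *\<^sub>O (\<Phi> s o\<^sub>L X))" for s
      by (intro bounded_linear_compose[OF bounded_linear_scale_op]
          bounded_bilinear.bounded_linear_right[OF bounded_bilinear_blinfun_compose])
    have "((\<lambda>s. c *\<^sub>O (\<Phi> s o\<^sub>L U s) - (\<Sum>k<n. c *\<^sub>O (\<Phi> s o\<^sub>L (c ^ k *\<^sub>O (propagator k s o\<^sub>L U 0)))))
        has_integral (U t - U 0 - (\<Sum>k<n. c ^ Suc k *\<^sub>O (propagator (Suc k) t o\<^sub>L U 0)))) {0..t}"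
      by (intro has_integral_diff has_integral_sum U Q) simp
    moreover have "U t - U 0 - (\<Sum>k<n. c ^ Suc k *\<^sub>O (propagator (Suc k) t o\<^sub>L U 0)) = D (Suc n) t"
    proof -
      have "c ^ 0 *\<^sub>O (propagator 0 t o\<^sub>L U 0) = U 0" by (rule blinfun_eqI) simp
      then show ?thesis unfolding D_def sum.lessThan_Suc_shift by simp
    qed
    moreover have "c *\<^sub>O (\<Phi> s o\<^sub>L U s) - (\<Sum>k<n. c *\<^sub>O (\<Phi> s o\<^sub>L (c ^ k *\<^sub>O (propagator k s o\<^sub>L U 0))))
        = c *\<^sub>O (\<Phi> s o\<^sub>L D n s)" for s
      unfolding D_def
      by (simp add: linear_diff[OF bounded_linear.linear[OF lin]]
          linear_sum[OF bounded_linear.linear[OF lin]])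
    ultimately show ?thesis by simp
  qed
  obtain C where C: "\<And>t. t \<in> {0..1} \<Longrightarrow> norm (U t) \<le> C"
    using compact_imp_bounded[OF compact_continuous_image[OF cont compact_Icc]]
    unfolding bounded_iff by (metis imageI)
  have bound: "norm (D n t) \<le> C * (a * t) ^ n / fact n" if "t \<in> {0..1}" for n t
    using that
  proof (induction n arbitrary: t)
    case 0
    then show ?case using C by (simp add: D_def)
  next
    case (Suc n)
    let ?p = "\<lambda>s. C * (a * s) ^ Suc n / fact (Suc n)"
    let ?d = "\<lambda>s. a * (C * (a * s) ^ n / fact n)"
    \<comment> \<open>the pointwise bound may fail on \<open>N\<close>, so the majorant is changed there\<close>
    have "((\<lambda>s. if s \<in> N then norm (c *\<^sub>O (\<Phi> s o\<^sub>L D n s)) else ?d s) has_integral (?p t - ?p 0)) {0..t}"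
    proof (rule has_integral_spike_finite[OF finite_exceptions])
      show "(?d has_integral (?p t - ?p 0)) {0..t}"
      proof (rule fundamental_theorem_of_calculus)
        fix s
        have "(?p has_real_derivative C * (real (Suc n) * (a * s) ^ n * a) / fact (Suc n)) (at s)"
          by (auto intro!: derivative_eq_intros simp del: power_Suc fact_Suc)
        also have "C * (real (Suc n) * (a * s) ^ n * a) / fact (Suc n) = ?d s"
          by (simp add: field_simps del: of_nat_Suc)
        finally show "(?p has_vector_derivative ?d s) (at s within {0..t})"
          by (simp add: has_real_derivative_iff_has_vector_derivative has_vector_derivative_at_within
              del: power_Suc fact_Suc)
      qed (use Suc.prems in simp)
    qed simp
    moreover have "norm (c *\<^sub>O (\<Phi> s o\<^sub>L D n s)) \<le> ?d s" if s: "s \<in> {0..t}" "s \<notin> N" for s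
    proof -
      have s': "s \<in> {0..1}" using s(1) Suc.prems by auto
      have "norm (c *\<^sub>O (\<Phi> s o\<^sub>L D n s)) \<le> cmod c * (norm (\<Phi> s) * norm (D n s))"
        using norm_blinfun_compose by (intro order_trans[OF norm_scale_op_le] mult_left_mono) auto
      also have "\<dots> \<le> cmod c * (M * (C * (a * s) ^ n / fact n))"
        using Suc.IH[OF s'] norm_le[of s] s(2) s'
        by (intro mult_left_mono mult_mono) (auto intro: order_trans[OF norm_ge_zero])
      finally show ?thesis by (simp add: a_def mult_ac)
    qed
    ultimately have "norm (integral {0..t} (\<lambda>s. c *\<^sub>O (\<Phi> s o\<^sub>L D n s))) \<le> ?p t - ?p 0"
      using integral_norm_bound_integral[OF has_integral_integrable[OF D_Suc[OF Suc.prems, of n]],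
          of "\<lambda>s. if s \<in> N then norm (c *\<^sub>O (\<Phi> s o\<^sub>L D n s)) else ?d s"]
      by (simp add: has_integral_iff)
    then show ?case using integral_unique[OF D_Suc[OF Suc.prems, of n]] by simp
  qed
  have "(\<lambda>n. C * (a ^ n / fact n)) \<longlonglongrightarrow> C * 0"
    using summable_LIMSEQ_zero[OF summable_exp[of a]]
    by (intro tendsto_mult tendsto_const) (simp add: divide_inverse mult.commute)
  then have "(\<lambda>n. D n 1) \<longlonglongrightarrow> 0"
    using bound[of 1] by (intro Lim_null_comparison[of "\<lambda>n. D n 1"]) (auto intro!: eventuallyI)
  then have "(\<lambda>n. U 1 - D n 1) \<longlonglongrightarrow> U 1 - 0" by (intro tendsto_intros)
  then show ?thesis by (simp add: sums_def D_def)
qed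

lemma Texp_eq_ode_solution:
  assumes "\<And>s. s \<in> {0..1} - N \<Longrightarrow> U 0 o\<^sub>L \<Phi> s = \<Phi> s" "\<And>s. s \<in> {0..1} - N \<Longrightarrow> \<Phi> s o\<^sub>L U 0 = \<Phi> s"
    and "continuous_on {0..1} U"
    and "\<And>s. s \<in> {0<..<1} - N \<Longrightarrow>
      (U has_vector_derivative (- 2 * complex_of_real pi * \<i>) *\<^sub>O (\<Phi> s o\<^sub>L U s)) (at s)"
  shows "U 1 = Texp (U 0) \<Phi>"
proof -
  let ?c = "- 2 * complex_of_real pi * \<i>"
  have "(\<lambda>k. ?c ^ Suc k *\<^sub>O (propagator (Suc k) 1 o\<^sub>L U 0)) sums
      (U 1 - ?c ^ 0 *\<^sub>O (propagator 0 1 o\<^sub>L U 0))"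
    using ode_solution_sums[OF assms(3,4)] by (subst sums_Suc_iff) simp
  moreover have "?c ^ 0 *\<^sub>O (propagator 0 1 o\<^sub>L U 0) = U 0" by (rule blinfun_eqI) simp
  moreover have "propagator (Suc k) 1 o\<^sub>L U 0 = iterated_integral \<Phi> (Suc k) (U 0) 1" for k
    using propagator_absorb[OF assms(1,2), of 1 k] iterated_integral_eq[of 1 "Suc k" "U 0"]
    by (simp del: propagator.simps iterated_integral.simps)
  ultimately have "(\<lambda>k. ?c ^ Suc k *\<^sub>O iterated_integral \<Phi> (Suc k) (U 0) 1) sums (U 1 - U 0)"
    by (simp only:)
  then show ?thesis unfolding Texp_def by (simp only: sums_unique[symmetric]) simp
qed

end

text \<open>The exceptional set is the set of partition points, enlarged by any given finite set.\<close>

lemma piecewise_continuous_S1_operator_path: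
  fixes \<Phi> :: "real \<Rightarrow> 'f::complex_hilbert \<Rightarrow>\<^sub>L 'f"
  assumes "piecewise_continuous_S1 \<Phi>" "finite N0"
  obtains N M where "operator_path \<Phi> N M" "N0 \<subseteq> N"
proof -
  obtain n t where t: "partition01 n t"
    and "\<forall>i<n. \<exists>B. (\<forall>r\<in>{t i<..<t (Suc i)}. \<Phi> r = B r) \<and>
       (\<forall>r\<in>{t i..t (Suc i)}. schatten 1 (B r) \<and> hermitian (B r) \<and>
          ((\<lambda>s. schatten_norm 1 (B s - B r)) \<longlongrightarrow> 0) (at r within {t i..t (Suc i)}))"
    using assms unfolding piecewise_continuous_S1_def by blast
  then obtain B where B: "\<And>i r. i < n \<Longrightarrow> r \<in> {t i<..<t (Suc i)} \<Longrightarrow> \<Phi> r = B i r"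
    and S1: "\<And>i r. i < n \<Longrightarrow> r \<in> {t i..t (Suc i)} \<Longrightarrow> schatten 1 (B i r)"
    and lim: "\<And>i r. i < n \<Longrightarrow> r \<in> {t i..t (Suc i)} \<Longrightarrow>
      ((\<lambda>s. schatten_norm 1 (B i s - B i r)) \<longlongrightarrow> 0) (at r within {t i..t (Suc i)})"
    by metis
  have cont: "continuous_on {t i..t (Suc i)} (B i)" if i: "i < n" for i
    unfolding continuous_on_def
  proof
    fix r assume r: "r \<in> {t i..t (Suc i)}"
    have "eventually (\<lambda>s. norm (B i s - B i r) \<le> schatten_norm 1 (B i s - B i r))
        (at r within {t i..t (Suc i)})"
      unfolding eventually_at_filter
      using S1[OF i] r by (intro always_eventually allI impI norm_le_schatten_norm_diff) auto
    from Lim_null_comparison[OF this lim[OF i r]]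
    show "(B i \<longlongrightarrow> B i r) (at r within {t i..t (Suc i)})" by (simp add: LIM_zero_iff)
  qed
  have int: "(\<lambda>s. \<Phi> s o\<^sub>L f s) integrable_on {0..1}" if f: "continuous_on {0..1} f"
    for f :: "real \<Rightarrow> 'f \<Rightarrow>\<^sub>L 'f"
  proof -
    show ?thesis
      using t
    proof (induction rule: partition01_induct)
      case (step i)
      have "(\<lambda>s. B i s o\<^sub>L f s) integrable_on {t i..t (Suc i)}"
        using step
        by (intro integrable_continuous_real bounded_bilinear.continuous_on[OF
            bounded_bilinear_blinfun_compose] cont continuous_on_subset[OF f]) auto
      then have "(\<lambda>s. \<Phi> s o\<^sub>L f s) integrable_on {t i..t (Suc i)}"
        by (rule integrable_spike_finite[of "{t i, t (Suc i)}", rotated 2])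
          (use B[OF step(1)] in auto)
      with step show ?case
        using Henstock_Kurzweil_Integration.integrable_combine[of 0 "t i" "t (Suc i)"
            "\<lambda>s. \<Phi> s o\<^sub>L f s"] by simp
    qed (auto intro: has_integral_integrable has_integral_refl(2))
  qed
  have "\<exists>M. \<forall>i<n. \<forall>r\<in>{t i..t (Suc i)}. norm (B i r) \<le> M"
  proof -
    have "bounded (\<Union>i<n. B i ` {t i..t (Suc i)})"
      by (intro bounded_UN ballI compact_imp_bounded compact_continuous_image cont) auto
    then show ?thesis unfolding bounded_iff by blast
  qed
  then obtain M where M: "\<And>i r. i < n \<Longrightarrow> r \<in> {t i..t (Suc i)} \<Longrightarrow> norm (B i r) \<le> M"
    by blast
  have "operator_path \<Phi> (N0 \<union> t ` {..n}) M"
  proof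
    fix s assume "s \<in> {0..1} - (N0 \<union> t ` {..n})"
    then obtain i where i: "i < n" "s \<in> {t i<..<t (Suc i)}"
      using partition01_interior[OF t, of s] by auto
    then show "norm (\<Phi> s) \<le> M" "clin (\<Phi> s)"
      using M[OF i(1)] S1[OF i(1)] B[OF i] by (auto intro: schatten_imp_clin[of 1])
  qed (use assms int in auto)
  then show thesis using that by blast
qed

section \<open>Linear operator pencils\<close>

lemma has_vector_derivative_quotient:
  fixes f :: "real \<Rightarrow> 'a::real_normed_vector"
  assumes "\<And>y. f y - f x = (y - x) *\<^sub>R g y" and "(g \<longlongrightarrow> D) (at x)"
  shows "(f has_vector_derivative D) (at x)"
proof -
  have "((\<lambda>y. norm (g y - D)) \<longlongrightarrow> 0) (at x)"
    using assms(2) by (simp add: tendsto_norm_zero_iff LIM_zero_iff)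
  moreover have "norm ((f y - f x - (y - x) *\<^sub>R D) /\<^sub>R norm (y - x)) = norm (g y - D)" if "y \<noteq> x" for y
  proof -
    have "norm (((y - x) *\<^sub>R (g y - D)) /\<^sub>R norm (y - x)) = norm (g y - D)"
      using that by (simp add: abs_mult)
    then show ?thesis by (simp add: assms(1) scaleR_diff_right)
  qed
  then have "eventually (\<lambda>y. norm (g y - D) = norm ((f y - f x - (y - x) *\<^sub>R D) /\<^sub>R norm (y - x))) (at x)"
    by (auto simp: eventually_at_filter)
  ultimately have "((\<lambda>y. norm ((f y - f x - (y - x) *\<^sub>R D) /\<^sub>R norm (y - x))) \<longlongrightarrow> 0) (at x)"
    by (rule Lim_transform_eventually)
  then show ?thesis
    unfolding has_vector_derivative_def has_derivative_def tendsto_norm_zero_iff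
    by (simp add: bounded_linear_scaleR_left netlimit_at)
qed

text \<open>\<open>M(s') - M(s) = - (s' - s) M(s') X M(s)\<close>, which first bounds \<open>M(s')\<close> for \<open>s'\<close> near \<open>s\<close> and then
  shows that \<open>M(s')\<close> tends to \<open>M(s)\<close>.\<close>

lemma isCont_pencil_inverse:
  fixes X :: "'k::complex_hilbert \<Rightarrow>\<^sub>L 'k" and M :: "real \<Rightarrow> 'k \<Rightarrow>\<^sub>L 'k"
  assumes right: "\<And>s. (id_blinfun + s *\<^sub>R X) o\<^sub>L M s = id_blinfun"
    and left: "\<And>s. M s o\<^sub>L (id_blinfun + s *\<^sub>R X) = id_blinfun"
  shows "isCont M s"
proof -
  have diff: "M r - M s = (s - r) *\<^sub>R (M r o\<^sub>L X o\<^sub>L M s)" for r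
  proof -
    have "M r - M s = (M r o\<^sub>L ((id_blinfun + s *\<^sub>R X) o\<^sub>L M s)) - ((M r o\<^sub>L (id_blinfun + r *\<^sub>R X)) o\<^sub>L M s)"
      by (simp only: left right id_compose)
    also have "\<dots> = (s - r) *\<^sub>R (M r o\<^sub>L X o\<^sub>L M s)"
      by (simp add: compose_simps algebra_simps)
    finally show ?thesis .
  qed
  define c where "c = norm X * norm (M s)"
  have le: "norm (M r - M s) \<le> \<bar>s - r\<bar> * (norm (M r) * c)" for r
  proof -
    have "norm (M r o\<^sub>L X o\<^sub>L M s) \<le> norm (M r) * norm X * norm (M s)"
      by (meson mult_right_mono norm_blinfun_compose norm_ge_zero order_trans)
    from mult_left_mono[OF this, of "\<bar>s - r\<bar>"] show ?thesis
      by (simp add: diff c_def mult.assoc)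
  qed
  have "((\<lambda>r. \<bar>s - r\<bar> * c) \<longlongrightarrow> \<bar>s - s\<bar> * c) (at s)" by (intro tendsto_intros)
  then have ev: "eventually (\<lambda>r. \<bar>s - r\<bar> * c < 1 / 2) (at s)" by (intro order_tendstoD) auto
  have "norm (M r - M s) \<le> \<bar>s - r\<bar> * (2 * norm (M s) * c)" if "\<bar>s - r\<bar> * c < 1 / 2" for r
  proof -
    have "norm (M r) \<le> norm (M s) + norm (M r - M s)" by norm
    also have "\<dots> \<le> norm (M s) + norm (M r) * (\<bar>s - r\<bar> * c)" using le[of r] by (simp add: mult_ac)
    also have "\<dots> \<le> norm (M s) + norm (M r) * (1 / 2)"
      using that by (intro add_left_mono mult_left_mono) auto
    finally have "norm (M r) * c \<le> 2 * norm (M s) * c"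
      by (intro mult_right_mono) (auto simp: c_def)
    then show ?thesis by (intro order_trans[OF le] mult_left_mono) auto
  qed
  then have "eventually (\<lambda>r. norm (M r - M s) \<le> \<bar>s - r\<bar> * (2 * norm (M s) * c)) (at s)"
    using ev by (auto elim: eventually_mono)
  moreover have "((\<lambda>r. \<bar>s - r\<bar> * (2 * norm (M s) * c)) \<longlongrightarrow> \<bar>s - s\<bar> * (2 * norm (M s) * c)) (at s)"
    by (intro tendsto_intros)
  then have "((\<lambda>r. \<bar>s - r\<bar> * (2 * norm (M s) * c)) \<longlongrightarrow> 0) (at s)" by simp
  ultimately have "((\<lambda>r. M r - M s) \<longlongrightarrow> 0) (at s)" by (rule Lim_null_comparison)
  then show ?thesis by (simp add: isCont_def LIM_zero_iff)
qed

text \<open>The operators at a fixed energy along the line \<open>K + s V\<close>: \<open>Z\<close> and \<open>T\<close> are \<open>Z\<^sub>K\<close> and the boundary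
  value \<open>T\<^sub>K\<close> for the factorization \<open>V = G\<^sup>* J G\<close>, \<open>Ts s\<close> is the boundary value for \<open>K + s V\<close>, and \<open>P\<close> is
  the identity of the fibre of \<open>K\<close>.\<close>

locale boundary_value_pencil =
  fixes Z :: "'k::complex_hilbert \<Rightarrow>\<^sub>L 'f::complex_hilbert" and J T :: "'k \<Rightarrow>\<^sub>L 'k"
    and Ts :: "real \<Rightarrow> 'k \<Rightarrow>\<^sub>L 'k" and P :: "'f \<Rightarrow>\<^sub>L 'f"
  assumes Z: "schatten 2 Z" and J: "hermitian J" and T: "clin T" and Ts: "\<And>s. clin (Ts s)"
    and P: "hermitian P" "P o\<^sub>L Z = Z"
    and Im_T: "pi *\<^sub>R (adj Z o\<^sub>L Z) = Im_op T"
    and resolvent1: "\<And>s. Ts s = T - s *\<^sub>R (T o\<^sub>L J o\<^sub>L Ts s)"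
    and resolvent2: "\<And>s. Ts s = T - s *\<^sub>R (Ts s o\<^sub>L J o\<^sub>L T)"
begin

text \<open>The resolvent identities say that \<open>M s\<close> and \<open>L s\<close> are the inverses of \<open>1 + s T J\<close> and of
  \<open>1 + s J T\<close>; in particular both inverses exist for every \<open>s\<close>. \<open>rate s\<close> is the infinitesimal
  scattering matrix at \<open>K + s V\<close>, transported to the fibre of \<open>K\<close> by the wave matrices, and
  \<open>scat s\<close> is the stationary formula for the scattering matrix of the pair \<open>K + s V\<close>, \<open>K\<close>.\<close>

definition M :: "real \<Rightarrow> 'k \<Rightarrow>\<^sub>L 'k" where "M s = id_blinfun - s *\<^sub>R (Ts s o\<^sub>L J)"
definition L :: "real \<Rightarrow> 'k \<Rightarrow>\<^sub>L 'k" where "L s = id_blinfun - s *\<^sub>R (J o\<^sub>L Ts s)"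
definition rate :: "real \<Rightarrow> 'f \<Rightarrow>\<^sub>L 'f" where "rate s = Z o\<^sub>L L s o\<^sub>L J o\<^sub>L adj (L s) o\<^sub>L adj Z"
definition scat :: "real \<Rightarrow> 'f \<Rightarrow>\<^sub>L 'f"
  where "scat s = P - (2 * complex_of_real pi * \<i>) *\<^sub>O (Z o\<^sub>L (s *\<^sub>R J) o\<^sub>L M s o\<^sub>L adj Z)"

lemma clin_Z [simp]: "clin Z" using Z by (rule schatten_imp_clin)
lemma clin_J [simp]: "clin J" and adj_J [simp]: "adj J = J" using J by (auto simp: hermitian_iff_adj)
lemma clin_P [simp]: "clin P" and adj_P [simp]: "adj P = P" using P by (auto simp: hermitian_iff_adj)
lemma clin_L [simp]: "clin (L s)"
  unfolding L_def by (intro clin_diff clin_scaleR clin_compose clin_id clin_J Ts)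
lemma clin_M [simp]: "clin (M s)"
  unfolding M_def by (intro clin_diff clin_scaleR clin_compose clin_id clin_J Ts)

lemma adj_Z_P: "adj Z o\<^sub>L P = adj Z"
  using adj_compose[OF clin_P clin_Z] P(2) by simp

lemma M_inverse:
  "(id_blinfun + s *\<^sub>R (T o\<^sub>L J)) o\<^sub>L M s = id_blinfun"
  "M s o\<^sub>L (id_blinfun + s *\<^sub>R (T o\<^sub>L J)) = id_blinfun"
proof -
  have "(id_blinfun + s *\<^sub>R (T o\<^sub>L J)) o\<^sub>L M s
      = id_blinfun + s *\<^sub>R ((T - s *\<^sub>R (T o\<^sub>L J o\<^sub>L Ts s) - Ts s) o\<^sub>L J)"
    by (simp add: M_def compose_simps algebra_simps)
  then show "(id_blinfun + s *\<^sub>R (T o\<^sub>L J)) o\<^sub>L M s = id_blinfun"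
    by (simp flip: resolvent1)
  have "M s o\<^sub>L (id_blinfun + s *\<^sub>R (T o\<^sub>L J))
      = id_blinfun + s *\<^sub>R ((T - s *\<^sub>R (Ts s o\<^sub>L J o\<^sub>L T) - Ts s) o\<^sub>L J)"
    by (simp add: M_def compose_simps algebra_simps)
  then show "M s o\<^sub>L (id_blinfun + s *\<^sub>R (T o\<^sub>L J)) = id_blinfun"
    by (simp flip: resolvent2)
qed

lemma L_inverse:
  "(id_blinfun + s *\<^sub>R (J o\<^sub>L T)) o\<^sub>L L s = id_blinfun"
  "L s o\<^sub>L (id_blinfun + s *\<^sub>R (J o\<^sub>L T)) = id_blinfun"
proof -
  have "(id_blinfun + s *\<^sub>R (J o\<^sub>L T)) o\<^sub>L L s
      = id_blinfun + s *\<^sub>R (J o\<^sub>L (T - s *\<^sub>R (T o\<^sub>L J o\<^sub>L Ts s) - Ts s))"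
    by (simp add: L_def compose_simps algebra_simps)
  then show "(id_blinfun + s *\<^sub>R (J o\<^sub>L T)) o\<^sub>L L s = id_blinfun"
    by (simp flip: resolvent1)
  have "L s o\<^sub>L (id_blinfun + s *\<^sub>R (J o\<^sub>L T))
      = id_blinfun + s *\<^sub>R (J o\<^sub>L (T - s *\<^sub>R (Ts s o\<^sub>L J o\<^sub>L T) - Ts s))"
    by (simp add: L_def compose_simps algebra_simps)
  then show "L s o\<^sub>L (id_blinfun + s *\<^sub>R (J o\<^sub>L T)) = id_blinfun"
    by (simp flip: resolvent2)
qed

lemma inv_op_eq_M: "inv_op (id_blinfun + s *\<^sub>R (T o\<^sub>L J)) = M s"
  by (rule inv_opI) (rule M_inverse)+

lemma L_J: "L s o\<^sub>L J = J o\<^sub>L M s"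
  by (simp add: L_def M_def compose_simps)

lemma M_tendsto: "(M \<longlongrightarrow> M s) (at s)" and L_tendsto: "(L \<longlongrightarrow> L s) (at s)"
  using isCont_pencil_inverse[OF M_inverse] isCont_pencil_inverse[OF L_inverse]
  by (auto simp: isCont_def)

text \<open>The derivative of \<open>s M(s)\<close> is \<open>M(s)\<^sup>2\<close>, because \<open>(s' M(s') - s M(s)) / (s' - s) = M(s') M(s)\<close>
  and \<open>M\<close> is continuous.\<close>

lemma scat_has_vector_derivative:
  "(scat has_vector_derivative
    (- 2 * complex_of_real pi * \<i>) *\<^sub>O (Z o\<^sub>L J o\<^sub>L M s o\<^sub>L M s o\<^sub>L adj Z)) (at s)"
proof -
  have quot: "r *\<^sub>R M r - s *\<^sub>R M s = (r - s) *\<^sub>R (M r o\<^sub>L M s)" for r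
  proof -
    have "r *\<^sub>R M r - s *\<^sub>R M s = r *\<^sub>R (M r o\<^sub>L ((id_blinfun + s *\<^sub>R (T o\<^sub>L J)) o\<^sub>L M s))
        - s *\<^sub>R ((M r o\<^sub>L (id_blinfun + r *\<^sub>R (T o\<^sub>L J))) o\<^sub>L M s)"
      by (simp only: M_inverse id_compose)
    also have "\<dots> = (r - s) *\<^sub>R (M r o\<^sub>L M s)"
      by (simp add: compose_simps algebra_simps)
    finally show ?thesis .
  qed
  define c where "c = - 2 * complex_of_real pi * \<i>"
  define \<Theta> where "\<Theta> = (\<lambda>X. c *\<^sub>O (Z o\<^sub>L J o\<^sub>L X o\<^sub>L adj Z))"
  have lin: "bounded_linear \<Theta>"
    unfolding \<Theta>_def
    by (intro bounded_linear_compose[OF bounded_linear_scale_op]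
        bounded_linear_compose[OF bounded_bilinear.bounded_linear_left[OF bounded_bilinear_blinfun_compose]]
        bounded_bilinear.bounded_linear_right[OF bounded_bilinear_blinfun_compose])
  have "((\<lambda>r. r *\<^sub>R M r) has_vector_derivative (M s o\<^sub>L M s)) (at s)"
    by (rule has_vector_derivative_quotient[OF quot])
      (intro bounded_bilinear.tendsto[OF bounded_bilinear_blinfun_compose] M_tendsto tendsto_const)
  then have "((\<lambda>r. P + \<Theta> (r *\<^sub>R M r)) has_vector_derivative 0 + \<Theta> (M s o\<^sub>L M s)) (at s)"
    by (intro has_vector_derivative_add has_vector_derivative_const
        bounded_linear.has_vector_derivative[OF lin])
  moreover have "P + \<Theta> (r *\<^sub>R M r) = scat r" for r
    unfolding \<Theta>_def c_def scat_def
    by (rule blinfun_eqI) (simp add: blinfun.add_left blinfun.diff_left blinfun.scaleR_right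
        blinfun.scaleR_left scaleC_minus_left)
  ultimately show ?thesis by (simp add: \<Theta>_def c_def blinfun_compose_assoc)
qed

text \<open>Stationary form of the differential equation. With \<open>N = L\<^sup>* = (1 + s T\<^sup>* J)\<^sup>-\<^sup>1\<close> and
  \<open>2 \<pi> i Z\<^sup>* Z = T - T\<^sup>*\<close> one has
  \<open>N (1 - 2 \<pi> i s Z\<^sup>* Z J M) = N (1 + s T J - s (T - T\<^sup>*) J) M = N (1 + s T\<^sup>* J) M = M\<close>.\<close>

lemma rate_scat: "rate s o\<^sub>L scat s = Z o\<^sub>L J o\<^sub>L M s o\<^sub>L M s o\<^sub>L adj Z"
proof -
  define c where "c = 2 * complex_of_real pi * \<i>"
  have ZZ: "c *\<^sub>O (adj Z o\<^sub>L Z) = T - adj T"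
  proof -
    have "c *\<^sub>O (adj Z o\<^sub>L Z) = (2 * \<i>) *\<^sub>O (pi *\<^sub>R (adj Z o\<^sub>L Z))"
      by (rule blinfun_eqI) (simp add: c_def blinfun.scaleR_left scaleC_scaleC mult_ac flip: scaleC_of_real)
    also have "\<dots> = T - adj T"
      unfolding Im_T Im_op_def by (rule blinfun_eqI) (simp add: scaleC_scaleC)
    finally show ?thesis .
  qed
  have N: "adj (L s) o\<^sub>L (id_blinfun + s *\<^sub>R (adj T o\<^sub>L J)) = id_blinfun"
  proof -
    have "adj ((id_blinfun + s *\<^sub>R (J o\<^sub>L T)) o\<^sub>L L s) = adj (L s) o\<^sub>L (id_blinfun + s *\<^sub>R (adj T o\<^sub>L J))"
      using T by (simp add: adj_compose adj_add adj_scaleR clin_add clin_scaleR clin_compose)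
    then show ?thesis by (simp add: L_inverse)
  qed
  have clin: "clin (Z o\<^sub>L L s o\<^sub>L J o\<^sub>L adj (L s))" by (intro clin_compose clin_adj) auto
  have "rate s o\<^sub>L scat s = (Z o\<^sub>L L s o\<^sub>L J o\<^sub>L adj (L s)) o\<^sub>L
      ((adj Z o\<^sub>L P) - c *\<^sub>O ((adj Z o\<^sub>L Z) o\<^sub>L (s *\<^sub>R J) o\<^sub>L M s o\<^sub>L adj Z))"
    by (simp add: rate_def scat_def compose_simps compose_scale_op clin_adj clin flip: c_def)
  also have "(adj Z o\<^sub>L P) - c *\<^sub>O ((adj Z o\<^sub>L Z) o\<^sub>L (s *\<^sub>R J) o\<^sub>L M s o\<^sub>L adj Z)
      = (id_blinfun - ((T - adj T) o\<^sub>L (s *\<^sub>R J) o\<^sub>L M s)) o\<^sub>L adj Z"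
    unfolding ZZ[symmetric] adj_Z_P by (simp add: compose_simps scale_op_compose scale_op_scaleR)
  also have "id_blinfun - ((T - adj T) o\<^sub>L (s *\<^sub>R J) o\<^sub>L M s)
      = ((id_blinfun + s *\<^sub>R (T o\<^sub>L J)) o\<^sub>L M s) - ((T - adj T) o\<^sub>L (s *\<^sub>R J) o\<^sub>L M s)"
    by (simp add: M_inverse)
  also have "\<dots> = (id_blinfun + s *\<^sub>R (adj T o\<^sub>L J)) o\<^sub>L M s"
    by (simp add: compose_simps algebra_simps)
  finally have "rate s o\<^sub>L scat s = Z o\<^sub>L (L s o\<^sub>L J) o\<^sub>L
      (adj (L s) o\<^sub>L (id_blinfun + s *\<^sub>R (adj T o\<^sub>L J))) o\<^sub>L M s o\<^sub>L adj Z"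
    by (simp only: blinfun_compose_assoc)
  then show ?thesis unfolding N L_J by (simp add: blinfun_compose_assoc)
qed

lemma rate_P: "rate s o\<^sub>L P = rate s"
  by (simp add: rate_def blinfun_compose_assoc adj_Z_P)

text \<open>Conjugated by a bounded operator \<open>C\<close>, the rate has the form \<open>(C Z) Y(s) (C Z)\<^sup>*\<close> with \<open>C Z\<close>
  Hilbert-Schmidt and \<open>Y\<close> norm continuous.\<close>

lemma conjugated_rate:
  assumes C: "clin C"
  defines "R \<equiv> \<lambda>s. C o\<^sub>L rate s o\<^sub>L adj C"
  shows "schatten 1 (R s)" and "hermitian (R s)"
    and "((\<lambda>r. schatten_norm 1 (R r - R s)) \<longlongrightarrow> 0) (at s)"
proof -
  define Y where "Y = (\<lambda>s. L s o\<^sub>L J o\<^sub>L adj (L s))"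
  have Y: "clin (Y s)" for s unfolding Y_def by (intro clin_compose clin_adj) auto
  have CZ: "schatten 2 (C o\<^sub>L Z)" using C Z by (rule schatten_2_compose)
  have R: "R s = (C o\<^sub>L Z) o\<^sub>L Y s o\<^sub>L adj (C o\<^sub>L Z)" for s
    using C by (simp add: R_def rate_def Y_def adj_compose compose_simps)
  show "schatten 1 (R s)" unfolding R using CZ Y by (rule schatten_1_sandwich)
  have "adj (Y s) = Y s"
    by (simp add: Y_def adj_compose adj_adj clin_compose clin_adj blinfun_compose_assoc)
  then show "hermitian (R s)"
    unfolding R hermitian_iff_adj using C Y
    by (simp add: adj_compose adj_adj clin_compose clin_adj blinfun_compose_assoc)
  have "(Y \<longlongrightarrow> Y s) (at s)"
    unfolding Y_def
    by (intro bounded_bilinear.tendsto[OF bounded_bilinear_blinfun_compose] tendsto_const L_tendsto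
        adj_tendsto) auto
  then have "((\<lambda>r. norm (Y r - Y s)) \<longlongrightarrow> 0) (at s)"
    by (simp add: tendsto_norm_zero_iff LIM_zero_iff)
  then have lim: "((\<lambda>r. 2 * (norm (Y r - Y s) * (\<Sum>n. (sing_num n (C o\<^sub>L Z))\<^sup>2))) \<longlongrightarrow> 0) (at s)"
    by (intro tendsto_mult_right_zero tendsto_mult_left_zero)
  have "R r - R s = (C o\<^sub>L Z) o\<^sub>L (Y r - Y s) o\<^sub>L adj (C o\<^sub>L Z)" for r
    unfolding R by (simp add: compose_simps)
  then have "norm (schatten_norm 1 (R r - R s)) \<le> 2 * (norm (Y r - Y s) * (\<Sum>n. (sing_num n (C o\<^sub>L Z))\<^sup>2))" for r
    using schatten_norm_1_sandwich_le[OF CZ clin_diff[OF Y Y], of r s]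
    by (simp add: schatten_norm_def)
  then show "((\<lambda>r. schatten_norm 1 (R r - R s)) \<longlongrightarrow> 0) (at s)"
    by (intro Lim_null_comparison[OF always_eventually lim] allI)
qed

end

section \<open>Stationary scattering theory at a fixed energy\<close>

text \<open>\<open>Z K V\<close> and \<open>T K V\<close> stand for \<open>Z\<^sub>K\<close> and the boundary value \<open>T\<^sub>K\<close> from the upper half plane, both taken
  with the factor \<open>G\<close> of \<open>V\<close>, and \<open>P K\<close> for the identity of the fibre of \<open>K\<close>. The analysis of
  resolvents enters only through \<open>resolvent_identity\<close>.\<close>

locale stationary_scattering =
  fixes A :: "'h::complex_hilbert graph_op set" and A0 :: "('h \<Rightarrow>\<^sub>L 'h) set"
    and J :: "('h \<Rightarrow>\<^sub>L 'h) \<Rightarrow> ('k::complex_hilbert \<Rightarrow>\<^sub>L 'k)"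
    and Z :: "'h graph_op \<Rightarrow> ('h \<Rightarrow>\<^sub>L 'h) \<Rightarrow> ('k \<Rightarrow>\<^sub>L 'f::complex_hilbert)"
    and T :: "'h graph_op \<Rightarrow> ('h \<Rightarrow>\<^sub>L 'h) \<Rightarrow> ('k \<Rightarrow>\<^sub>L 'k)"
    and P :: "'h graph_op \<Rightarrow> ('f \<Rightarrow>\<^sub>L 'f)"
    and S :: "'h graph_op \<Rightarrow> 'h graph_op \<Rightarrow> ('f \<Rightarrow>\<^sub>L 'f)"
    and w :: "pm \<Rightarrow> 'h graph_op \<Rightarrow> 'h graph_op \<Rightarrow> ('f \<Rightarrow>\<^sub>L 'f)"
  assumes subspace_A0: "subspace A0"
    and perturb_closed: "\<And>K V. K \<in> A \<Longrightarrow> V \<in> A0 \<Longrightarrow> K \<boxplus> V \<in> A"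
    and hermitian_J: "\<And>V. V \<in> A0 \<Longrightarrow> hermitian (J V)"
    and homogeneous: "\<And>K V r. V \<in> A0 \<Longrightarrow> V \<noteq> 0 \<Longrightarrow> r \<noteq> 0 \<Longrightarrow>
      Z K (r *\<^sub>R V) = Z K V \<and> T K (r *\<^sub>R V) = T K V \<and> J (r *\<^sub>R V) = r *\<^sub>R J V"
    and schatten_Z: "\<And>K V. K \<in> A \<Longrightarrow> V \<in> A0 \<Longrightarrow> schatten 2 (Z K V)"
    and clin_T: "\<And>K V. K \<in> A \<Longrightarrow> V \<in> A0 \<Longrightarrow> clin (T K V)"
    and Im_T: "\<And>K V. K \<in> A \<Longrightarrow> V \<in> A0 \<Longrightarrow> pi *\<^sub>R (adj (Z K V) o\<^sub>L Z K V) = Im_op (T K V)"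
    and resolvent_identity: "\<And>K V s. K \<in> A \<Longrightarrow> V \<in> A0 \<Longrightarrow>
      T (K \<boxplus> s *\<^sub>R V) V = T K V - s *\<^sub>R (T K V o\<^sub>L J V o\<^sub>L T (K \<boxplus> s *\<^sub>R V) V)"
    and clin_w: "\<And>s K0 K1. K0 \<in> A \<Longrightarrow> K1 \<in> A \<Longrightarrow> clin (w s K1 K0)"
    and w_isometry: "\<And>s K0 K1. K0 \<in> A \<Longrightarrow> K1 \<in> A \<Longrightarrow> adj (w s K1 K0) o\<^sub>L w s K1 K0 = P K0"
    and S_stationary: "\<And>K V. K \<in> A \<Longrightarrow> V \<in> A0 \<Longrightarrow>
      S (K \<boxplus> V) K = P K - (2 * complex_of_real pi * \<i>) *\<^sub>O (Z K V o\<^sub>L J V o\<^sub>L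
        inv_op (id_blinfun + (T K V o\<^sub>L J V)) o\<^sub>L adj (Z K V))"
    and w_stationary: "\<And>K V. K \<in> A \<Longrightarrow> V \<in> A0 \<Longrightarrow>
      w Pos (K \<boxplus> V) K o\<^sub>L Z K V o\<^sub>L (id_blinfun - (J V o\<^sub>L T (K \<boxplus> V) V)) = Z (K \<boxplus> V) V"
    and S_w: "\<And>K0 K1. K0 \<in> A \<Longrightarrow> K1 \<in> A \<Longrightarrow> S K1 K0 = adj (w Pos K1 K0) o\<^sub>L w Neg K1 K0"
    and w_adj: "\<And>s K0 K1. K0 \<in> A \<Longrightarrow> K1 \<in> A \<Longrightarrow> adj (w s K1 K0) = w s K0 K1"
    and w_chain: "\<And>s K0 K1 K2. K0 \<in> A \<Longrightarrow> K1 \<in> A \<Longrightarrow> K2 \<in> A \<Longrightarrow>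
      w s K2 K0 = w s K2 K1 o\<^sub>L w s K1 K0"
begin

lemma scaleR_A0: "V \<in> A0 \<Longrightarrow> r *\<^sub>R V \<in> A0"
  using subspace_A0 by (rule subspace_mul)

lemma zero_A0: "0 \<in> A0"
  using subspace_A0 by (rule subspace_0)

lemma perturb_scaleR_closed: "K \<in> A \<Longrightarrow> V \<in> A0 \<Longrightarrow> K \<boxplus> s *\<^sub>R V \<in> A"
  by (intro perturb_closed scaleR_A0)

lemma w_inverse: "K0 \<in> A \<Longrightarrow> K1 \<in> A \<Longrightarrow> w s K0 K1 o\<^sub>L w s K1 K0 = P K0"
  using w_isometry w_adj by metis

lemma w_refl: "K \<in> A \<Longrightarrow> w s K K = P K"
  using w_chain[of K K K s] w_inverse by metis

lemma hermitian_P: "K \<in> A \<Longrightarrow> hermitian (P K)"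
  using w_adj[of K K Pos] clin_w[of K K Pos] by (simp add: w_refl hermitian_iff_adj)

lemma P_w: "K0 \<in> A \<Longrightarrow> K1 \<in> A \<Longrightarrow> P K1 o\<^sub>L w s K1 K0 = w s K1 K0"
  using w_chain[of K0 K1 K1 s] by (simp add: w_refl)

lemma P_P: "K \<in> A \<Longrightarrow> P K o\<^sub>L P K = P K"
  using P_w[of K K Pos] by (simp add: w_refl)

lemma S_refl: "K \<in> A \<Longrightarrow> S K K = P K"
  using S_w[of K K] hermitian_P[of K] by (simp add: w_refl hermitian_iff_adj P_P)

text \<open>\<open>K\<close> is the perturbation by \<open>V\<close> of \<open>K - V\<close>, so the stationary formula for the wave matrix
  presents \<open>Z K V\<close> as an operator whose range lies in the fibre of \<open>K\<close>.\<close>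

lemma P_Z:
  assumes "K \<in> A" "V \<in> A0"
  shows "P K o\<^sub>L Z K V = Z K V"
proof -
  define K' where "K' = K \<boxplus> (-1) *\<^sub>R V"
  have K': "K' \<in> A" unfolding K'_def using assms by (rule perturb_scaleR_closed)
  have K: "K' \<boxplus> V = K" by (simp add: K'_def perturb_perturb)
  have "Z K V = w Pos K K' o\<^sub>L (Z K' V o\<^sub>L (id_blinfun - (J V o\<^sub>L T K V)))"
    using w_stationary[OF K' assms(2)] by (simp add: K blinfun_compose_assoc)
  then show ?thesis using P_w[OF K' assms(1)] by (metis blinfun_compose_assoc)
qed

lemma pencil_along_line:
  assumes "K \<in> A" "V \<in> A0"
  shows "boundary_value_pencil (Z K V) (J V) (T K V) (\<lambda>s. T (K \<boxplus> s *\<^sub>R V) V) (P K)"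
proof
  fix s
  let ?K = "K \<boxplus> s *\<^sub>R V"
  have K: "?K \<in> A" using assms by (rule perturb_scaleR_closed)
  show "clin (T ?K V)" using K assms(2) by (rule clin_T)
  show "T ?K V = T K V - s *\<^sub>R (T K V o\<^sub>L J V o\<^sub>L T ?K V)"
    using assms by (rule resolvent_identity)
  have "?K \<boxplus> (- s) *\<^sub>R V = K" by (simp add: perturb_perturb)
  then have "T K V = T ?K V + s *\<^sub>R (T ?K V o\<^sub>L J V o\<^sub>L T K V)"
    using resolvent_identity[OF K assms(2), of "- s"] by simp
  then show "T ?K V = T K V - s *\<^sub>R (T ?K V o\<^sub>L J V o\<^sub>L T K V)"
    unfolding eq_diff_eq by (rule sym)
qed (intro schatten_Z hermitian_J clin_T hermitian_P P_Z Im_T assms)+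

text \<open>The zero perturbation may have a nonzero factorization \<open>0 = G\<^sup>* J G\<close>, but it does not
  contribute: the stationary formulas for \<open>K + 0 = K\<close> give \<open>Z J T = 0\<close> and
  \<open>Z J (1 + T J)\<^sup>-\<^sup>1 Z\<^sup>* = 0\<close>. Here \<open>(1 + T J)\<^sup>-\<^sup>1 = 1 - T J\<close>, so that the first identity reduces the
  second one to \<open>Z J Z\<^sup>* = 0\<close>.\<close>

lemma rate_zero_perturbation:
  assumes K: "K \<in> A"
  shows "Z K 0 o\<^sub>L J 0 o\<^sub>L adj (Z K 0) = 0"
proof -
  interpret boundary_value_pencil "Z K 0" "J 0" "T K 0" "\<lambda>s. T (K \<boxplus> s *\<^sub>R 0) 0" "P K"
    using K zero_A0 by (rule pencil_along_line)
  have M: "M 1 = id_blinfun - (T K 0 o\<^sub>L J 0)" unfolding M_def by simp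
  have "Z K 0 o\<^sub>L (id_blinfun - (J 0 o\<^sub>L T K 0)) = Z K 0"
    using w_stationary[OF K zero_A0] K by (simp add: w_refl P_Z zero_A0)
  then have ZJT: "Z K 0 o\<^sub>L (J 0 o\<^sub>L T K 0) = 0" by (simp add: compose_simps)
  define Y where "Y = Z K 0 o\<^sub>L J 0 o\<^sub>L M 1 o\<^sub>L adj (Z K 0)"
  have "(2 * complex_of_real pi * \<i>) *\<^sub>O Y = 0"
    using S_stationary[OF K zero_A0] inv_op_eq_M[of 1] K by (simp add: S_refl Y_def)
  then have "(2 * complex_of_real pi * \<i>) *\<^sub>C Y x = 0" for x
    by (metis scale_op_apply blinfun.zero_left)
  then have "cmod (2 * complex_of_real pi * \<i>) * norm (Y x) = 0" for x
    by (metis norm_scaleC norm_zero)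
  then have "Y = 0" by (intro blinfun_eqI) simp
  moreover have "Y = (Z K 0 o\<^sub>L J 0 o\<^sub>L adj (Z K 0))
      - ((Z K 0 o\<^sub>L (J 0 o\<^sub>L T K 0)) o\<^sub>L J 0 o\<^sub>L adj (Z K 0))"
    unfolding Y_def M by (simp add: compose_simps)
  ultimately show ?thesis unfolding ZJT by simp
qed

text \<open>The integrand of the chronological exponential: \<open>K0\<close> is the initial point of the path, \<open>K\<close> the
  current one and \<open>V\<close> the velocity.\<close>

definition rate_at :: "'h graph_op \<Rightarrow> 'h graph_op \<Rightarrow> ('h \<Rightarrow>\<^sub>L 'h) \<Rightarrow> 'f \<Rightarrow>\<^sub>L 'f"
  where "rate_at K0 K V = w Pos K0 K o\<^sub>L (Z K V o\<^sub>L J V o\<^sub>L adj (Z K V)) o\<^sub>L w Pos K K0"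

text \<open>The chain rule for the wave matrices splits off the constant factors between the fibres of \<open>K0\<close>
  and \<open>K\<close>. What remains compares \<open>K + s V\<close> with \<open>K\<close>: the wave matrix takes \<open>Z\<close> at \<open>K + s V\<close> back to
  \<open>Z L(s)\<close> at \<open>K\<close>.\<close>

lemma
  assumes K: "K \<in> A" "K0 \<in> A" and V: "V \<in> A0" "V \<noteq> 0"
  defines "C \<equiv> w Pos K0 K"
  shows rate_at_eq: "rate_at K0 (K \<boxplus> s *\<^sub>R V) V = C o\<^sub>L
      boundary_value_pencil.rate (Z K V) (J V) (\<lambda>s. T (K \<boxplus> s *\<^sub>R V) V) s o\<^sub>L adj C"
    and S_eq: "S (K \<boxplus> s *\<^sub>R V) K0 = C o\<^sub>L
      boundary_value_pencil.scat (Z K V) (J V) (\<lambda>s. T (K \<boxplus> s *\<^sub>R V) V) (P K) s o\<^sub>L w Neg K K0"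
proof -
  interpret boundary_value_pencil "Z K V" "J V" "T K V" "\<lambda>s. T (K \<boxplus> s *\<^sub>R V) V" "P K"
    using K(1) V(1) by (rule pencil_along_line)
  let ?K = "K \<boxplus> s *\<^sub>R V"
  have Ks: "?K \<in> A" using K(1) V(1) by (rule perturb_scaleR_closed)
  \<comment> \<open>homogeneity of the factorization requires \<open>s \<noteq> 0\<close>; for \<open>s = 0\<close> both sides reduce to \<open>Z K V\<close>\<close>
  have Zs: "w Pos K ?K o\<^sub>L Z ?K V = Z K V o\<^sub>L L s"
  proof (cases "s = 0")
    case True
    then show ?thesis using K V by (simp add: w_refl P_Z L_def)
  next
    case False
    have "w Pos ?K K o\<^sub>L Z K V o\<^sub>L L s = Z ?K V"
      using w_stationary[OF K(1) scaleR_A0[OF V(1)], of s] homogeneous[OF V False]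
      by (simp add: L_def compose_simps)
    then have "w Pos K ?K o\<^sub>L Z ?K V = (w Pos K ?K o\<^sub>L w Pos ?K K) o\<^sub>L Z K V o\<^sub>L L s"
      by (metis blinfun_compose_assoc)
    then show ?thesis using K V Ks by (simp add: w_inverse P_Z)
  qed
  have clin: "clin (w Pos K ?K)" "clin (Z ?K V)"
    using K V Ks clin_w schatten_Z schatten_imp_clin by blast+
  have "rate_at K0 ?K V = C o\<^sub>L (w Pos K ?K o\<^sub>L Z ?K V) o\<^sub>L J V o\<^sub>L
      (adj (Z ?K V) o\<^sub>L w Pos ?K K) o\<^sub>L w Pos K K0"
    unfolding rate_at_def C_def
    by (simp only: w_chain[OF Ks K(1) K(2), of Pos] w_chain[OF K(2) K(1) Ks, of Pos]
        blinfun_compose_assoc)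
  also have "adj (Z ?K V) o\<^sub>L w Pos ?K K = adj (w Pos K ?K o\<^sub>L Z ?K V)"
    using clin K Ks by (simp add: adj_compose w_adj)
  also have "w Pos K K0 = adj C"
    unfolding C_def using K by (simp add: w_adj)
  finally show "rate_at K0 ?K V = C o\<^sub>L rate s o\<^sub>L adj C"
    unfolding Zs by (simp add: rate_def adj_compose compose_simps)
  have "S ?K K = scat s"
  proof (cases "s = 0")
    case True
    have "c *\<^sub>O (0 :: 'f \<Rightarrow>\<^sub>L 'f) = 0" for c by (rule blinfun_eqI) simp
    then show ?thesis using True K by (simp add: S_refl scat_def)
  next
    case False
    then show ?thesis
      using S_stationary[OF K(1) scaleR_A0[OF V(1)], of s] homogeneous[OF V False] inv_op_eq_M[of s]
      by (simp add: scat_def compose_simps)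
  qed
  moreover have "S ?K K0 = C o\<^sub>L S ?K K o\<^sub>L w Neg K K0"
    using S_w[OF K(2) Ks] S_w[OF K(1) Ks] w_adj[OF K(2) Ks, of Pos] w_adj[OF K(1) Ks, of Pos]
      w_chain[OF Ks K(1) K(2), of Pos] w_chain[OF K(2) K(1) Ks, of Neg]
    by (simp add: C_def blinfun_compose_assoc)
  ultimately show "S ?K K0 = C o\<^sub>L scat s o\<^sub>L w Neg K K0" by simp
qed

text \<open>Along a line \<open>K + s V\<close> in the affine space the scattering matrix solves the differential
  equation defining the chronological exponential, and its rate is trace class continuous.\<close>

lemma scattering_along_line:
  assumes K: "K \<in> A" "K0 \<in> A" and V: "V \<in> A0"
  defines "R \<equiv> \<lambda>s. rate_at K0 (K \<boxplus> s *\<^sub>R V) V"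
  shows "schatten 1 (R s)" and "hermitian (R s)"
    and "((\<lambda>r. schatten_norm 1 (R r - R s)) \<longlongrightarrow> 0) (at s)"
    and "((\<lambda>s. S (K \<boxplus> s *\<^sub>R V) K0) has_vector_derivative
      (- 2 * complex_of_real pi * \<i>) *\<^sub>O (R s o\<^sub>L S (K \<boxplus> s *\<^sub>R V) K0)) (at s)"
proof -
  have "schatten 1 (R s) \<and> hermitian (R s) \<and>
    ((\<lambda>r. schatten_norm 1 (R r - R s)) \<longlongrightarrow> 0) (at s) \<and>
    ((\<lambda>s. S (K \<boxplus> s *\<^sub>R V) K0) has_vector_derivative
      (- 2 * complex_of_real pi * \<i>) *\<^sub>O (R s o\<^sub>L S (K \<boxplus> s *\<^sub>R V) K0)) (at s)"
  proof (cases "V = 0")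
    case True
    have R: "R = (\<lambda>_. 0)"
      using rate_zero_perturbation[OF K(1)] by (simp add: R_def True rate_at_def)
    have sing: "sing_num n (0 :: 'f \<Rightarrow>\<^sub>L 'f) = 0" for n
      using sing_num_le_norm[of n "0 :: 'f \<Rightarrow>\<^sub>L 'f"] by (intro antisym sing_num_nonneg) simp
    have "c *\<^sub>O (0 :: 'f \<Rightarrow>\<^sub>L 'f) = 0" for c by (rule blinfun_eqI) simp
    then show ?thesis
      by (simp add: R True schatten_def schatten_norm_def sing hermitian_def)
  next
    case False
    interpret boundary_value_pencil "Z K V" "J V" "T K V" "\<lambda>s. T (K \<boxplus> s *\<^sub>R V) V" "P K"
      using K(1) V by (rule pencil_along_line)
    define C where "C = w Pos K0 K"
    define C' where "C' = w Neg K K0"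
    have C: "clin C" unfolding C_def using K by (simp add: clin_w)
    have CC: "adj C o\<^sub>L C = P K" unfolding C_def using K by (simp add: w_isometry)
    have R: "R s = C o\<^sub>L rate s o\<^sub>L adj C" for s
      unfolding R_def C_def using rate_at_eq[OF K V False] .
    have U: "S (K \<boxplus> s *\<^sub>R V) K0 = C o\<^sub>L scat s o\<^sub>L C'" for s
      unfolding C_def C'_def using S_eq[OF K V False] .
    have "bounded_linear (\<lambda>X. C o\<^sub>L X o\<^sub>L C')"
      by (intro bounded_linear_compose[OF bounded_bilinear.bounded_linear_left[OF bounded_bilinear_blinfun_compose]]
          bounded_bilinear.bounded_linear_right[OF bounded_bilinear_blinfun_compose])
    from bounded_linear.has_vector_derivative[OF this scat_has_vector_derivative[of s]]
    have "((\<lambda>s. C o\<^sub>L scat s o\<^sub>L C') has_vector_derivative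
        C o\<^sub>L ((- 2 * complex_of_real pi * \<i>) *\<^sub>O (rate s o\<^sub>L scat s)) o\<^sub>L C') (at s)"
      by (simp only: rate_scat)
    moreover have "C o\<^sub>L (c *\<^sub>O (rate s o\<^sub>L scat s)) o\<^sub>L C' = c *\<^sub>O (R s o\<^sub>L (C o\<^sub>L scat s o\<^sub>L C'))" for c
    proof -
      have "R s o\<^sub>L (C o\<^sub>L scat s o\<^sub>L C') = C o\<^sub>L (rate s o\<^sub>L (adj C o\<^sub>L C)) o\<^sub>L scat s o\<^sub>L C'"
        by (simp only: R blinfun_compose_assoc)
      then show ?thesis
        unfolding CC rate_P by (simp only: compose_scale_op[OF C] scale_op_compose blinfun_compose_assoc)
    qed
    ultimately show ?thesis
      unfolding U using conjugated_rate[OF C, of s] by (simp only: R)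
  qed
  then show "schatten 1 (R s)" and "hermitian (R s)"
    and "((\<lambda>r. schatten_norm 1 (R r - R s)) \<longlongrightarrow> 0) (at s)"
    and "((\<lambda>s. S (K \<boxplus> s *\<^sub>R V) K0) has_vector_derivative
      (- 2 * complex_of_real pi * \<i>) *\<^sub>O (R s o\<^sub>L S (K \<boxplus> s *\<^sub>R V) K0)) (at s)"
    by blast+
qed

text \<open>At a partition point the path may fail to be differentiable, so that nothing is known about
  \<open>vector_derivative W\<close> and the integrand there; these finitely many times are put into the
  exceptional set.\<close>

lemma S_eq_Texp_path:
  assumes H0: "H0 \<in> A" and path: "piecewise_linear_path A0 W" and W0: "W 0 = 0"
  defines "\<Phi> \<equiv> \<lambda>r. rate_at H0 (H0 \<boxplus> W r) (vector_derivative W (at r))"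
  shows "piecewise_continuous_S1 \<Phi>" and "S (H0 \<boxplus> W 1) H0 = Texp (P H0) \<Phi>"
proof -
  obtain n t where t: "partition01 n t" and W_A0: "\<And>r. r \<in> {0..1} \<Longrightarrow> W r \<in> A0"
    and "\<forall>i<n. \<exists>V\<in>A0. \<forall>r\<in>{t i..t (Suc i)}. W r = W (t i) + (r - t i) *\<^sub>R V"
    using path unfolding piecewise_linear_path_def by blast
  then obtain V where V: "\<And>i. i < n \<Longrightarrow> V i \<in> A0"
    and W: "\<And>i r. i < n \<Longrightarrow> r \<in> {t i..t (Suc i)} \<Longrightarrow> W r = W (t i) + (r - t i) *\<^sub>R V i"
    by metis
  define K where "K = (\<lambda>i. H0 \<boxplus> W (t i))"
  define R where "R = (\<lambda>i s. rate_at H0 (K i \<boxplus> s *\<^sub>R V i) (V i))"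
  define U where "U = (\<lambda>r. S (H0 \<boxplus> W r) H0)"
  define Us where "Us = (\<lambda>i s. S (K i \<boxplus> s *\<^sub>R V i) H0)"
  let ?c = "- 2 * complex_of_real pi * \<i>"
  have K: "K i \<in> A" if "i < n" for i
    unfolding K_def using that partition01_bounds[OF t, of i] by (intro perturb_closed H0 W_A0) auto
  have HW: "H0 \<boxplus> W r = K i \<boxplus> (r - t i) *\<^sub>R V i" if "i < n" "r \<in> {t i..t (Suc i)}" for i r
    unfolding K_def perturb_perturb using W[OF that] by simp
  have U: "U r = Us i (r - t i)" if "i < n" "r \<in> {t i..t (Suc i)}" for i r
    unfolding U_def Us_def using HW[OF that] by simp
  have \<Phi>: "\<Phi> r = R i (r - t i)" if i: "i < n" and r: "r \<in> {t i<..<t (Suc i)}" for i r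
  proof -
    have "((\<lambda>r. W (t i) + (r - t i) *\<^sub>R V i) has_vector_derivative V i) (at r)"
      by (auto intro!: derivative_eq_intros)
    then have "(W has_vector_derivative V i) (at r)"
      by (rule has_vector_derivative_transform_within_open[OF _ open_greaterThanLessThan r])
        (rule sym, rule W[OF i], auto)
    then have "vector_derivative W (at r) = V i" by (rule vector_derivative_at)
    then show ?thesis unfolding \<Phi>_def R_def using HW[OF i, of r] r by simp
  qed
  have line: "schatten 1 (R i s)" "hermitian (R i s)"
      "((\<lambda>r. schatten_norm 1 (R i r - R i s)) \<longlongrightarrow> 0) (at s)"
      "(Us i has_vector_derivative ?c *\<^sub>O (R i s o\<^sub>L Us i s)) (at s)" if "i < n" for i s
    unfolding R_def Us_def using scattering_along_line[OF K[OF that] H0 V[OF that]] by simp_all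
  have R_lim: "((\<lambda>s. schatten_norm 1 (R i (s - t i) - R i (r - t i))) \<longlongrightarrow> 0) (at r within X)"
    if "i < n" for i r X
    using LIM_offset[OF line(3)[OF that, of "r - t i"], of "- t i"]
    by (auto intro: tendsto_within_subset)
  have dUs: "((\<lambda>r. Us i (r - t i)) has_vector_derivative
      ?c *\<^sub>O (R i (r - t i) o\<^sub>L Us i (r - t i))) (at r)" if "i < n" for i r
  proof -
    have "((\<lambda>r. r - t i) has_vector_derivative 1) (at r)"
      by (auto intro!: derivative_eq_intros)
    from vector_diff_chain_at[OF this line(4)[OF that, of "r - t i"]]
    show ?thesis by (simp add: o_def)
  qed
  show pc: "piecewise_continuous_S1 \<Phi>"
    unfolding piecewise_continuous_S1_def
  proof (intro exI conjI allI impI)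
    show "partition01 n t" by (fact t)
    fix i assume i: "i < n"
    show "\<forall>r\<in>{t i<..<t (Suc i)}. \<Phi> r = R i (r - t i)"
      using \<Phi>[OF i] by blast
    show "\<forall>r\<in>{t i..t (Suc i)}. schatten 1 (R i (r - t i)) \<and> hermitian (R i (r - t i)) \<and>
        ((\<lambda>s. schatten_norm 1 (R i (s - t i) - R i (r - t i))) \<longlongrightarrow> 0) (at r within {t i..t (Suc i)})"
      using line(1,2)[OF i] R_lim[OF i] by blast
  qed
  obtain N M where "operator_path \<Phi> N M" and N: "t ` {..n} \<subseteq> N"
    using piecewise_continuous_S1_operator_path[OF pc, of "t ` {..n}"] by blast
  then interpret operator_path \<Phi> N M by simp
  have U0: "U 0 = P H0" using W0 H0 by (simp add: U_def S_refl)
  have abs: "P H0 o\<^sub>L \<Phi> s = \<Phi> s" "\<Phi> s o\<^sub>L P H0 = \<Phi> s" if "s \<in> {0..1}" for s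
  proof -
    have Hs: "H0 \<boxplus> W s \<in> A" using that by (intro perturb_closed H0 W_A0)
    show "P H0 o\<^sub>L \<Phi> s = \<Phi> s"
      using P_w[OF Hs H0, of Pos] by (simp add: \<Phi>_def rate_at_def flip: blinfun_compose_assoc)
    show "\<Phi> s o\<^sub>L P H0 = \<Phi> s"
      using w_chain[OF H0 H0 Hs, of Pos] H0 by (simp add: \<Phi>_def rate_at_def w_refl blinfun_compose_assoc)
  qed
  have "continuous_on {0..1} U"
    using t
  proof (induction rule: partition01_induct)
    case (step i)
    have "continuous_on {t i..t (Suc i)} (\<lambda>r. Us i (r - t i))"
      using dUs[OF step(1)] by (intro continuous_at_imp_continuous_on ballI has_vector_derivative_continuous)
    then have "continuous_on {t i..t (Suc i)} U"
      by (rule continuous_on_eq) (rule U[OF step(1), symmetric])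
    then have "continuous_on ({0..t i} \<union> {t i..t (Suc i)}) U"
      using step by (intro continuous_on_closed_Un) auto
    moreover have "{0..t i} \<union> {t i..t (Suc i)} = {0..t (Suc i)}" using step by auto
    ultimately show ?case by simp
  qed simp
  moreover have "(U has_vector_derivative ?c *\<^sub>O (\<Phi> s o\<^sub>L U s)) (at s)" if s: "s \<in> {0<..<1} - N" for s
  proof -
    have "s \<in> {0..1}" "s \<notin> t ` {..n}" using s N by auto
    then obtain i where i: "i < n" "s \<in> {t i<..<t (Suc i)}"
      using partition01_interior[OF t] by blast
    have "((\<lambda>r. Us i (r - t i)) has_vector_derivative ?c *\<^sub>O (\<Phi> s o\<^sub>L U s)) (at s)"
      using dUs[OF i(1)] \<Phi>[OF i] U[OF i(1), of s] i(2) by simp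
    then show ?thesis
      by (rule has_vector_derivative_transform_within_open[OF _ open_greaterThanLessThan i(2)])
        (use U[OF i(1)] in auto)
  qed
  ultimately have "U 1 = Texp (U 0) \<Phi>"
    using abs by (intro Texp_eq_ode_solution) (auto simp: U0)
  then show "S (H0 \<boxplus> W 1) H0 = Texp (P H0) \<Phi>" unfolding U0 by (simp add: U_def)
qed

end

theorem theorem2p5:
  fixes Hb H0 H1 :: "'h::{complex_hilbert, second_countable_topology} graph_op"
    and A0 :: "('h \<Rightarrow>\<^sub>L 'h) set" and X :: "('h \<Rightarrow>\<^sub>L 'h) topology"
    and A :: "'h graph_op set"
    and \<sigma> \<Lambda> :: "real set"
    and G :: "('h \<Rightarrow>\<^sub>L 'h) \<Rightarrow> ('h \<Rightarrow>\<^sub>L 'k::complex_hilbert)"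
    and J :: "('h \<Rightarrow>\<^sub>L 'h) \<Rightarrow> ('k \<Rightarrow>\<^sub>L 'k)"
    and h :: "'h graph_op \<Rightarrow> real \<Rightarrow> 'f::complex_hilbert set"
    and e :: "'h graph_op \<Rightarrow> nat \<Rightarrow> real \<Rightarrow> 'f"
    and F :: "'h graph_op \<Rightarrow> 'h \<Rightarrow> real \<Rightarrow> 'f"
    and S :: "real \<Rightarrow> 'h graph_op \<Rightarrow> 'h graph_op \<Rightarrow> ('f \<Rightarrow>\<^sub>L 'f)"
    and w :: "pm \<Rightarrow> real \<Rightarrow> 'h graph_op \<Rightarrow> 'h graph_op \<Rightarrow> ('f \<Rightarrow>\<^sub>L 'f)"
    and W :: "real \<Rightarrow> ('h \<Rightarrow>\<^sub>L 'h)" and l :: real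
  assumes A_def: "A = affine_space Hb A0" and \<Lambda>_def: "\<Lambda> = interior \<sigma>"
    and trace_compatible: "trace_compatible Hb A0 X"
    and wave_ops: "\<And>s K0 K1. K0 \<in> A \<Longrightarrow> K1 \<in> A \<Longrightarrow> wave_op_complete s K1 K0"
    and same_ac_spectrum: "\<And>K. K \<in> A \<Longrightarrow> ac_spectrum K = \<sigma>"
    and factorization: "factorization A0 G J"
    and limiting_absorption: "limiting_absorption A A0 G \<Lambda>"
    and fibres: "\<And>K. K \<in> A \<Longrightarrow> measurable_field \<sigma> (h K) (e K)"
    and diagonalizes: "\<And>K. K \<in> A \<Longrightarrow> diagonalizes \<sigma> (h K) (e K) K (F K)"
    and Z_bounded: "\<And>K V \<mu>. K \<in> A \<Longrightarrow> V \<in> A0 \<Longrightarrow> \<mu> \<in> \<Lambda> \<Longrightarrow>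
          bounded_linear (\<lambda>\<eta>. F K (adj (G V) \<eta>) \<mu>)"
    and Z_Hilbert_Schmidt: "\<And>K V \<mu>. K \<in> A \<Longrightarrow> V \<in> A0 \<Longrightarrow> \<mu> \<in> \<Lambda> \<Longrightarrow>
          schatten 2 (Z_op (F K) \<mu> (G V))"
    and Z_adj_Z: "\<And>K V \<mu>. K \<in> A \<Longrightarrow> V \<in> A0 \<Longrightarrow> \<mu> \<in> \<Lambda> \<Longrightarrow>
          pi *\<^sub>R (adj (Z_op (F K) \<mu> (G V)) o\<^sub>L Z_op (F K) \<mu> (G V))
            = Im_op (boundary_value Pos \<mu> K (G V))"
    and w_fibre: "\<And>s K0 K1 \<eta>. K0 \<in> A \<Longrightarrow> K1 \<in> A \<Longrightarrow>
          AE \<mu> in lebesgue_on \<sigma>. F K1 (wave_op s K1 K0 \<eta>) \<mu> = w s \<mu> K1 K0 (F K0 \<eta> \<mu>)"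
    and S_fibre: "\<And>K0 K1 \<eta>. K0 \<in> A \<Longrightarrow> K1 \<in> A \<Longrightarrow>
          AE \<mu> in lebesgue_on \<sigma>. F K0 (scattering_op K1 K0 \<eta>) \<mu> = S \<mu> K1 K0 (F K0 \<eta> \<mu>)"
    and w_unitary: "\<And>s K0 K1 \<mu>. K0 \<in> A \<Longrightarrow> K1 \<in> A \<Longrightarrow> \<mu> \<in> \<Lambda> \<Longrightarrow>
          unitary_between (h K0 \<mu>) (h K1 \<mu>) (w s \<mu> K1 K0)"
    and S_unitary: "\<And>K0 K1 \<mu>. K0 \<in> A \<Longrightarrow> K1 \<in> A \<Longrightarrow> \<mu> \<in> \<Lambda> \<Longrightarrow>
          unitary_between (h K0 \<mu>) (h K0 \<mu>) (S \<mu> K1 K0)"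
    and S_stationary: "\<And>K V \<mu>. K \<in> A \<Longrightarrow> V \<in> A0 \<Longrightarrow> \<mu> \<in> \<Lambda> \<Longrightarrow>
          S \<mu> (K \<boxplus> V) K = orth_proj (h K \<mu>) -
            (2 * complex_of_real pi * \<i>) *\<^sub>O (Z_op (F K) \<mu> (G V) o\<^sub>L J V o\<^sub>L
              inv_op (id_blinfun + (boundary_value Pos \<mu> K (G V) o\<^sub>L J V)) o\<^sub>L
              adj (Z_op (F K) \<mu> (G V)))"
    and w_stationary: "\<And>s K V \<mu>. K \<in> A \<Longrightarrow> V \<in> A0 \<Longrightarrow> \<mu> \<in> \<Lambda> \<Longrightarrow>
          w s \<mu> (K \<boxplus> V) K o\<^sub>L Z_op (F K) \<mu> (G V) o\<^sub>L
            (id_blinfun - (J V o\<^sub>L boundary_value s \<mu> (K \<boxplus> V) (G V)))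
          = Z_op (F (K \<boxplus> V)) \<mu> (G V)"
    and S_w: "\<And>K0 K1 \<mu>. K0 \<in> A \<Longrightarrow> K1 \<in> A \<Longrightarrow> \<mu> \<in> \<Lambda> \<Longrightarrow>
          S \<mu> K1 K0 = adj (w Pos \<mu> K1 K0) o\<^sub>L w Neg \<mu> K1 K0"
    and w_adj: "\<And>s K0 K1 \<mu>. K0 \<in> A \<Longrightarrow> K1 \<in> A \<Longrightarrow> \<mu> \<in> \<Lambda> \<Longrightarrow>
          adj (w s \<mu> K1 K0) = w s \<mu> K0 K1"
    and w_chain: "\<And>s K0 K1 K2 \<mu>. K0 \<in> A \<Longrightarrow> K1 \<in> A \<Longrightarrow> K2 \<in> A \<Longrightarrow> \<mu> \<in> \<Lambda> \<Longrightarrow>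
          w s \<mu> K2 K0 = w s \<mu> K2 K1 o\<^sub>L w s \<mu> K1 K0"
    and H0: "H0 \<in> A" and H1: "H1 \<in> A"
    and path: "piecewise_linear_path A0 W" "W 0 = 0" "H0 \<boxplus> W 1 = H1"
    and l: "l \<in> \<Lambda>"
  shows "let \<Phi> = \<lambda>r. let Hr = H0 \<boxplus> W r; V = vector_derivative W (at r) in
               w Pos l H0 Hr o\<^sub>L infinitesimal_scattering (F Hr) l (G V) (J V) o\<^sub>L w Pos l Hr H0
         in piecewise_continuous_S1 \<Phi> \<and> S l H1 H0 = Texp (orth_proj (h H0 l)) \<Phi>"
proof -
  have A0: "subspace A0" "\<And>V. V \<in> A0 \<Longrightarrow> hermitian V" and Hb: "self_adjoint Hb"
    using trace_compatible by (auto simp: trace_compatible_def)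
  have closed: "K \<boxplus> V \<in> A" if "K \<in> A" "V \<in> A0" for K V
    using that subspace_add[OF A0(1)] unfolding A_def affine_space_def
    by (auto simp: perturb_perturb)
  have sa: "self_adjoint K" if "K \<in> A" for K
    using that A0(2) Hb unfolding A_def affine_space_def by (auto intro: self_adjoint_perturb)
  note fact = factorization[unfolded factorization_def]
  let ?Z = "\<lambda>K V. Z_op (F K) l (G V)" and ?T = "\<lambda>K V. boundary_value Pos l K (G V)"
  interpret stationary_scattering A A0 J ?Z ?T "\<lambda>K. orth_proj (h K l)" "S l" "\<lambda>s. w s l"
  proof
    \<comment> \<open>\<open>s V\<close> is factored with the same \<open>G\<close> and with \<open>s J\<close>, here also for \<open>s = 0\<close> and for \<open>V = 0\<close>\<close>
    fix K V and s :: real assume K: "K \<in> A" and V: "V \<in> A0"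
    have sV: "s *\<^sub>R V \<in> A0" using A0(1) V by (rule subspace_mul)
    have "s *\<^sub>R V = adj (G V) o\<^sub>L (s *\<^sub>R J V) o\<^sub>L G V"
      using fact V by (metis bounded_bilinear.scaleR_left[OF bounded_bilinear_blinfun_compose]
          bounded_bilinear.scaleR_right[OF bounded_bilinear_blinfun_compose])
    from boundary_value_resolvent_identity[OF sa[OF K] sa[OF closed[OF K sV]] this]
    show "?T (K \<boxplus> s *\<^sub>R V) V = ?T K V - s *\<^sub>R (?T K V o\<^sub>L J V o\<^sub>L ?T (K \<boxplus> s *\<^sub>R V) V)"
      using limiting_absorption_tendsto(1)[OF limiting_absorption _ V l] K closed[OF K sV]
      by (auto simp: compose_simps)
  next
    fix K V assume "K \<in> A" "V \<in> A0"
    then show "clin (?T K V)"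
      using limiting_absorption_tendsto(2)[OF limiting_absorption _ _ l] by blast
  next
    fix K V assume "K \<in> A" "V \<in> A0"
    then show "schatten 2 (?Z K V)" using Z_Hilbert_Schmidt l by blast
  next
    fix s K0 K1 assume "K0 \<in> A" "K1 \<in> A"
    from w_unitary[OF this l, of s]
    show "clin (w s l K1 K0)" "adj (w s l K1 K0) o\<^sub>L w s l K1 K0 = orth_proj (h K0 l)"
      by (auto simp: unitary_between_def)
  next
    fix s K0 K1 K2 assume "K0 \<in> A" "K1 \<in> A" "K2 \<in> A"
    then show "w s l K2 K0 = w s l K2 K1 o\<^sub>L w s l K1 K0" using w_chain l by blast
  qed (use A0(1) closed fact l Z_Hilbert_Schmidt Z_adj_Z S_stationary w_stationary S_w w_adj in
      \<open>simp_all\<close>)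
  show ?thesis
    using S_eq_Texp_path[OF H0 path(1,2)] path(3)
    by (simp add: Let_def rate_at_def infinitesimal_scattering_def)
qed

end
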